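(* Let $M$ be a manifold, $E$ an oriented real vector bundle over $M$ of rank $4n$, $h$ a neutral metric of $E$ and $\nabla$ an $h$-connection of $E$ (i.e. $\nabla h=0$). Let $\varepsilon\in\{+,-\}$, let $J$ be an $\varepsilon$-paracomplex structure of $E$, and let $e=(e_1,\dots,e_{4n})$ be an admissible frame field of $J$. Let $\omega=[\omega^i_j]$ be the connection form of $\nabla$ with respect to $e$, i.e. $\nabla e=e\omega$. Then for $\mu\in\{+,-\}$, the following are equivalent (on the domain of $e$): (a) $\nabla J=\alpha\otimes N$ for a $1$-form $\alpha$ and an $\varepsilon$-nilpotent structure $N$ related to $J$ by $(e,\mu)$; (b) there is a $1$-form $\alpha$ such that for all $i,j\in\{1,\dots,n\}$ $$\mu\bigl(\omega^{n+i}_{j}+\varepsilon^{\delta_{i1}}\omega^{3n+i}_{2n+j}\bigr)=\omega^{n+i}_{2n+j}+\varepsilon^{\delta_{i1}}\omega^{3n+i}_{j}=\alpha\,\delta^i_j,$$ $$\omega^{i}_{j}-\omega^{2n+i}_{2n+j}=\omega^{i}_{2n+j}-\omega^{2n+i}_{j}=0,$$ $$\omega^{n+i}_{n+j}-\varepsilon^{\delta_{i1}+\delta_{j1}}\omega^{3n+i}_{3n+j}=\omega^{n+i}_{3n+j}-\varepsilon^{\delta_{i1}+\delta_{j1}}\omega^{3n+i}_{n+j}=0.$$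
   Context: Signs $\varepsilon,\mu\in\{+,-\}$ are identified with $\pm1$; $\delta_{ij}=\delta^i_j$ is the Kronecker delta. $I_n$, $O_n$ are the $n\times n$ unit and zero matrices, $I_{n,+}:=I_n$, $I_{n,-}:=\mathrm{diag}(-1,1,\dots,1)$ (so $I_{1,-}=-1$), $I'_{4n,\varepsilon}:=\mathrm{diag}(I_n,I_n,I_n,I_{n,\varepsilon})$, and $$\Lambda_n:=\begin{bmatrix}O_n&-I_n&O_n&I_n\\ I_n&O_n&I_n&O_n\\ O_n&I_n&O_n&-I_n\\ I_n&O_n&I_n&O_n\end{bmatrix}.$$ A neutral metric of $E$ is a nondegenerate metric of signature $(2n,2n)$. An ordered pseudo-orthonormal local frame field $e=(e_1,\dots,e_{4n})$ of $E$ satisfies $h(e_i,e_j)=0$ for $i\neq j$, $h(e_i,e_i)=1$ for $i\le 2n$ (space-like) and $h(e_i,e_i)=-1$ for $i>2n$ (time-like). Frames are written as row vectors; a section of $\mathrm{End}\,E$ acts entrywise on a row. $\varepsilon$-nilpotent structure: a section $N$ of $\mathrm{End}\,E$ such that near each point there is an ordered pseudo-orthonormal local frame field $e$ giving the orientation of $E$ with $N(eI'_{4n,\varepsilon})=eI'_{4n,\varepsilon}\Lambda_n$; such an $e$ is an admissible frame field of $N$. $\varepsilon$-paracomplex structure: a section $J$ of $\mathrm{End}\,E$ such that (i) $J$ is a paracomplex structure of $E$ ($J^2=\mathrm{id}$ with $\pm1$-eigenbundles of equal rank), (ii) $J$ is $h$-reversing: $h(JX,JY)=-h(X,Y)$,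 (iii) near each point there is an ordered pseudo-orthonormal local frame field $e$ giving the orientation of $E$ with $$J(eI'_{4n,\varepsilon})=eI'_{4n,\varepsilon}\begin{bmatrix}O_n&O_n&I_n&O_n\\ O_n&O_n&O_n&-I_n\\ I_n&O_n&O_n&O_n\\ O_n&-I_n&O_n&O_n\end{bmatrix};$$ such an $e$ is an admissible frame field of $J$. For $\mu\in\{+,-\}$, $e(\mu):=(e_1,\dots,e_{2n},\mu e_{2n+1},\dots,\mu e_{4n})$. An $\varepsilon$-nilpotent structure $N$ (on the domain of $e$) is related to $J$ by $(e,\mu)$ if $e$ is an admissible frame field of $J$ and $e(\mu)$ is an admissible frame field of $N$. *)

theory Defs
  imports "HOL-Analysis.Analysis" "Jordan_Normal_Form.Determinant"
begin

section \<open>Smooth manifolds\<close>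

text \<open>Class C^k on an open subset of a finite-dimensional normed space.\<close>

primrec Ck_on :: "nat \<Rightarrow> 'b::real_normed_vector set \<Rightarrow> ('b \<Rightarrow> 'c::real_normed_vector) \<Rightarrow> bool"
where
  "Ck_on 0 S f \<longleftrightarrow> continuous_on S f"
| "Ck_on (Suc k) S f \<longleftrightarrow>
     f differentiable_on S \<and> (\<forall>v. Ck_on k S (\<lambda>x. frechet_derivative f (at x) v))"

definition smooth_on :: "'b::real_normed_vector set \<Rightarrow> ('b \<Rightarrow> 'c::real_normed_vector) \<Rightarrow> bool"
where
  "smooth_on S f \<longleftrightarrow> (\<forall>k. Ck_on k S f)"

type_synonym ('m, 'b) atlas = "('m set \<times> ('m \<Rightarrow> 'b)) set"

text \<open>
  The manifold is the whole type \<^typ>\<open>'m\<close>.  The model space \<^typ>\<open>'b\<close> is an arbitrary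
  finite-dimensional normed space; unlike the class \<^class>\<open>euclidean_space\<close> this does not
  exclude dimension 0.  An atlas need not be maximal.
\<close>

definition smooth_manifold ::
  "('m::{t2_space,second_countable_topology}, 'b::real_normed_vector) atlas \<Rightarrow> bool"
where
  "smooth_manifold A \<longleftrightarrow>
     (\<exists>B::'b set. finite B \<and> span B = UNIV) \<and>
     (\<forall>(V, \<phi>)\<in>A. open V \<and> open (\<phi> ` V) \<and> (\<exists>\<psi>. homeomorphism V (\<phi> ` V) \<phi> \<psi>)) \<and>
     (\<Union>(V, \<phi>)\<in>A. V) = UNIV \<and>
     (\<forall>(V, \<phi>)\<in>A. \<forall>(V', \<phi>')\<in>A. smooth_on (\<phi> ` (V \<inter> V')) (\<phi>' \<circ> inv_into V \<phi>))"

definition smooth_fun ::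
  "('m::topological_space, 'b::real_normed_vector) atlas \<Rightarrow> 'm set \<Rightarrow> ('m \<Rightarrow> real) \<Rightarrow> bool"
where
  "smooth_fun A W f \<longleftrightarrow>
     (\<forall>(V, \<phi>)\<in>A. smooth_on (\<phi> ` (V \<inter> W)) (f \<circ> inv_into V \<phi>))"

text \<open>
  Tangent vectors at \<open>x\<close> are the derivations of the algebra of germs at \<open>x\<close> of smooth
  functions.  They are extended by 0 to functions not smooth near \<open>x\<close>, so that distinct
  functionals are distinct tangent vectors; addition and scaling are pointwise.
\<close>

type_synonym 'm tangent = "('m \<Rightarrow> real) \<Rightarrow> real"

definition tangent_space ::
  "('m::topological_space, 'b::real_normed_vector) atlas \<Rightarrow> 'm \<Rightarrow> 'm tangent set"
where
  "tangent_space A x = {v.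
     (\<forall>f. \<not> (\<exists>W. open W \<and> x \<in> W \<and> smooth_fun A W f) \<longrightarrow> v f = 0) \<and>
     (\<forall>f g W. open W \<and> x \<in> W \<and> (\<forall>y\<in>W. f y = g y) \<longrightarrow> v f = v g) \<and>
     (\<forall>f g W. open W \<and> x \<in> W \<and> smooth_fun A W f \<and> smooth_fun A W g \<longrightarrow>
        v (\<lambda>y. f y + g y) = v f + v g \<and>
        (\<forall>c. v (\<lambda>y. c * f y) = c * v f) \<and>
        v (\<lambda>y. f y * g y) = v f * g x + f x * v g)}"

definition vector_field ::
  "('m::topological_space, 'b::real_normed_vector) atlas \<Rightarrow> 'm set \<Rightarrow> ('m \<Rightarrow> 'm tangent) \<Rightarrow> bool"
where
  "vector_field A U X \<longleftrightarrow>
     (\<forall>x\<in>U. X x \<in> tangent_space A x) \<and>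
     (\<forall>W f. open W \<and> W \<subseteq> U \<and> smooth_fun A W f \<longrightarrow> smooth_fun A W (\<lambda>x. X x f))"

definition one_form ::
  "('m::topological_space, 'b::real_normed_vector) atlas \<Rightarrow> 'm set
     \<Rightarrow> ('m \<Rightarrow> 'm tangent \<Rightarrow> real) \<Rightarrow> bool"
where
  "one_form A U \<alpha> \<longleftrightarrow>
     (\<forall>x\<in>U. \<forall>v\<in>tangent_space A x. \<forall>w\<in>tangent_space A x. \<forall>c.
        \<alpha> x (\<lambda>f. v f + w f) = \<alpha> x v + \<alpha> x w \<and> \<alpha> x (\<lambda>f. c * v f) = c * \<alpha> x v) \<and>
     (\<forall>W X. open W \<and> W \<subseteq> U \<and> vector_field A W X \<longrightarrow> smooth_fun A W (\<lambda>x. \<alpha> x (X x)))"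


section \<open>Vector bundles\<close>

text \<open>Bases, frames and square matrices of size \<open>r\<close> are indexed by \<open>1, \<dots>, r\<close>;
  values at other indices are irrelevant.\<close>

definition ordered_basis :: "nat \<Rightarrow> 'v::real_vector set \<Rightarrow> (nat \<Rightarrow> 'v) \<Rightarrow> bool"
where
  "ordered_basis r V b \<longleftrightarrow>
     inj_on b {1..r} \<and> independent (b ` {1..r}) \<and> span (b ` {1..r}) = V"

definition same_orientation :: "nat \<Rightarrow> (nat \<Rightarrow> 'v::real_vector) \<Rightarrow> (nat \<Rightarrow> 'v) \<Rightarrow> bool"
where
  "same_orientation r b b' \<longleftrightarrow>
     (\<exists>g::nat \<Rightarrow> nat \<Rightarrow> real.
        (\<forall>j\<in>{1..r}. b' j = (\<Sum>i\<in>{1..r}. g i j *\<^sub>R b i)) \<and>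
        Determinant.det (Matrix.mat r r (\<lambda>(i, j). g (Suc i) (Suc j))) > 0)"

text \<open>
  The fibres are subspaces of an arbitrary ambient real vector space \<^typ>\<open>'v\<close>; no relation
  between the fibres over different points is assumed, so every vector bundle is isomorphic to
  one of this form (for instance inside the direct sum of all its fibres).  Local
  trivialisations over \<open>V\<close> are given by the frames over \<open>V\<close> corresponding to them.
\<close>

record ('m, 'v) vbundle =
  fibre :: "'m \<Rightarrow> 'v set"
  trivs :: "('m set \<times> (nat \<Rightarrow> 'm \<Rightarrow> 'v)) set"

definition smooth_section ::
  "('m::topological_space, 'b::real_normed_vector) atlas \<Rightarrow> nat \<Rightarrow> ('m, 'v::real_vector) vbundle
     \<Rightarrow> 'm set \<Rightarrow> ('m \<Rightarrow> 'v) \<Rightarrow> bool"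
where
  "smooth_section A r E W s \<longleftrightarrow>
     (\<forall>x\<in>W. s x \<in> fibre E x) \<and>
     (\<forall>(V, b)\<in>trivs E. \<exists>c. (\<forall>i\<in>{1..r}. smooth_fun A (V \<inter> W) (c i)) \<and>
        (\<forall>x\<in>V \<inter> W. s x = (\<Sum>i\<in>{1..r}. c i x *\<^sub>R b i x)))"

definition local_frame ::
  "('m::topological_space, 'b::real_normed_vector) atlas \<Rightarrow> nat \<Rightarrow> ('m, 'v::real_vector) vbundle
     \<Rightarrow> 'm set \<Rightarrow> (nat \<Rightarrow> 'm \<Rightarrow> 'v) \<Rightarrow> bool"
where
  "local_frame A r E U e \<longleftrightarrow>
     open U \<and> (\<forall>i\<in>{1..r}. smooth_section A r E U (e i)) \<and>
     (\<forall>x\<in>U. ordered_basis r (fibre E x) (\<lambda>i. e i x))"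

text \<open>
  Requiring every trivialising frame to be a local frame says in particular that all transition
  matrices are smooth.
\<close>

definition vector_bundle ::
  "('m::topological_space, 'b::real_normed_vector) atlas \<Rightarrow> nat \<Rightarrow> ('m, 'v::real_vector) vbundle
     \<Rightarrow> bool"
where
  "vector_bundle A r E \<longleftrightarrow>
     (\<Union>(V, b)\<in>trivs E. V) = UNIV \<and> (\<forall>(V, b)\<in>trivs E. local_frame A r E V b)"

text \<open>An orientation: \<open>ori x\<close> is the set of positive ordered bases of the fibre over \<open>x\<close>.\<close>

definition bundle_orientation ::
  "('m::topological_space, 'b::real_normed_vector) atlas \<Rightarrow> nat \<Rightarrow> ('m, 'v::real_vector) vbundle
     \<Rightarrow> ('m \<Rightarrow> (nat \<Rightarrow> 'v) set) \<Rightarrow> bool"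
where
  "bundle_orientation A r E ori \<longleftrightarrow>
     (\<forall>x. \<forall>b\<in>ori x. ordered_basis r (fibre E x) b \<and>
        (\<forall>b'. ordered_basis r (fibre E x) b' \<longrightarrow> (b' \<in> ori x \<longleftrightarrow> same_orientation r b b'))) \<and>
     (\<forall>x. \<exists>W b. x \<in> W \<and> local_frame A r E W b \<and> (\<forall>y\<in>W. (\<lambda>i. b i y) \<in> ori y))"

definition End_section ::
  "('m::topological_space, 'b::real_normed_vector) atlas \<Rightarrow> nat \<Rightarrow> ('m, 'v::real_vector) vbundle
     \<Rightarrow> 'm set \<Rightarrow> ('m \<Rightarrow> 'v \<Rightarrow> 'v) \<Rightarrow> bool"
where
  "End_section A r E U J \<longleftrightarrow>
     (\<forall>x\<in>U. \<forall>u\<in>fibre E x. \<forall>w\<in>fibre E x. \<forall>c.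
        J x u \<in> fibre E x \<and> J x (u + w) = J x u + J x w \<and> J x (c *\<^sub>R u) = c *\<^sub>R J x u) \<and>
     (\<forall>W s. open W \<and> W \<subseteq> U \<and> smooth_section A r E W s \<longrightarrow>
        smooth_section A r E W (\<lambda>x. J x (s x)))"


section \<open>Neutral metrics and metric connections\<close>

text \<open>The first \<open>m\<close> vectors are space-like, the remaining ones time-like.\<close>

definition pseudo_orthonormal :: "nat \<Rightarrow> nat \<Rightarrow> ('v \<Rightarrow> 'v \<Rightarrow> real) \<Rightarrow> (nat \<Rightarrow> 'v) \<Rightarrow> bool"
where
  "pseudo_orthonormal r m g b \<longleftrightarrow>
     (\<forall>i\<in>{1..r}. \<forall>j\<in>{1..r}.
        g (b i) (b j) = (if i \<noteq> j then 0 else if i \<le> m then 1 else -1))"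

definition neutral_metric ::
  "('m::topological_space, 'b::real_normed_vector) atlas \<Rightarrow> nat \<Rightarrow> ('m, 'v::real_vector) vbundle
     \<Rightarrow> ('m \<Rightarrow> 'v \<Rightarrow> 'v \<Rightarrow> real) \<Rightarrow> bool"
where
  "neutral_metric A n E h \<longleftrightarrow>
     (\<forall>x. \<forall>u\<in>fibre E x. \<forall>u'\<in>fibre E x. \<forall>w\<in>fibre E x. \<forall>c.
        h x u w = h x w u \<and> h x (u + u') w = h x u w + h x u' w \<and>
        h x (c *\<^sub>R u) w = c * h x u w) \<and>
     (\<forall>x. \<forall>u\<in>fibre E x. (\<forall>w\<in>fibre E x. h x u w = 0) \<longrightarrow> u = 0) \<and>
     (\<forall>x. \<exists>b. ordered_basis (4 * n) (fibre E x) b \<and> pseudo_orthonormal (4 * n) (2 * n) (h x) b) \<and>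
     (\<forall>W s t. open W \<and> smooth_section A (4 * n) E W s \<and> smooth_section A (4 * n) E W t \<longrightarrow>
        smooth_fun A W (\<lambda>x. h x (s x) (t x)))"

text \<open>
  A connection as a sheaf morphism from sections of \<open>E\<close> to \<open>E\<close>-valued 1-forms:
  \<open>D x v s\<close> is the covariant derivative at \<open>x\<close> in direction \<open>v\<close> of a smooth section \<open>s\<close>
  defined near \<open>x\<close>, and depends only on the germ of \<open>s\<close> at \<open>x\<close>.
\<close>

type_synonym ('m, 'v) conn = "'m \<Rightarrow> 'm tangent \<Rightarrow> ('m \<Rightarrow> 'v) \<Rightarrow> 'v"

definition connection ::
  "('m::topological_space, 'b::real_normed_vector) atlas \<Rightarrow> nat \<Rightarrow> ('m, 'v::real_vector) vbundle
     \<Rightarrow> ('m, 'v) conn \<Rightarrow> bool"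
where
  "connection A r E D \<longleftrightarrow>
     (\<forall>W x s. open W \<and> x \<in> W \<and> smooth_section A r E W s \<longrightarrow>
        (\<forall>v\<in>tangent_space A x. \<forall>w\<in>tangent_space A x. \<forall>c.
           D x v s \<in> fibre E x \<and>
           D x (\<lambda>f. v f + w f) s = D x v s + D x w s \<and>
           D x (\<lambda>f. c * v f) s = c *\<^sub>R D x v s)) \<and>
     (\<forall>W x s t. open W \<and> x \<in> W \<and> smooth_section A r E W s \<and> smooth_section A r E W t \<longrightarrow>
        (\<forall>v\<in>tangent_space A x.
           D x v (\<lambda>y. s y + t y) = D x v s + D x v t \<and>
           ((\<forall>y\<in>W. s y = t y) \<longrightarrow> D x v s = D x v t) \<and>
           (\<forall>f. smooth_fun A W f \<longrightarrow>
              D x v (\<lambda>y. f y *\<^sub>R s y) = v f *\<^sub>R s x + f x *\<^sub>R D x v s))) \<and>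
     (\<forall>W X s. open W \<and> vector_field A W X \<and> smooth_section A r E W s \<longrightarrow>
        smooth_section A r E W (\<lambda>x. D x (X x) s))"

definition metric_connection ::
  "('m::topological_space, 'b::real_normed_vector) atlas \<Rightarrow> nat \<Rightarrow> ('m, 'v::real_vector) vbundle
     \<Rightarrow> ('m \<Rightarrow> 'v \<Rightarrow> 'v \<Rightarrow> real) \<Rightarrow> ('m, 'v) conn \<Rightarrow> bool"
where
  "metric_connection A r E h D \<longleftrightarrow> connection A r E D \<and>
     (\<forall>W x s t. open W \<and> x \<in> W \<and> smooth_section A r E W s \<and> smooth_section A r E W t \<longrightarrow>
        (\<forall>v\<in>tangent_space A x.
           v (\<lambda>y. h y (s y) (t y)) = h x (D x v s) (t x) + h x (s x) (D x v t)))"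

definition connection_form ::
  "('m::topological_space, 'b::real_normed_vector) atlas \<Rightarrow> nat \<Rightarrow> ('m, 'v::real_vector) conn
     \<Rightarrow> 'm set \<Rightarrow> (nat \<Rightarrow> 'm \<Rightarrow> 'v) \<Rightarrow> (nat \<Rightarrow> nat \<Rightarrow> 'm \<Rightarrow> 'm tangent \<Rightarrow> real) \<Rightarrow> bool"
where
  "connection_form A r D U e \<omega> \<longleftrightarrow>
     (\<forall>i\<in>{1..r}. \<forall>j\<in>{1..r}. one_form A U (\<omega> i j)) \<and>
     (\<forall>x\<in>U. \<forall>v\<in>tangent_space A x. \<forall>j\<in>{1..r}.
        D x v (e j) = (\<Sum>i\<in>{1..r}. \<omega> i j x v *\<^sub>R e i x))"

text \<open>The induced connection on \<open>End E\<close>, evaluated on a section \<open>s\<close>.\<close>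

definition cov_End :: "('m, 'v::real_vector) conn \<Rightarrow> ('m \<Rightarrow> 'v \<Rightarrow> 'v) \<Rightarrow> 'm \<Rightarrow> 'm tangent
     \<Rightarrow> ('m \<Rightarrow> 'v) \<Rightarrow> 'v"
where
  "cov_End D J x v s = D x v (\<lambda>y. J y (s y)) - J x (D x v s)"

definition cov_End_eq_tensor ::
  "('m::topological_space, 'b::real_normed_vector) atlas \<Rightarrow> nat \<Rightarrow> ('m, 'v::real_vector) vbundle
     \<Rightarrow> ('m, 'v) conn \<Rightarrow> 'm set \<Rightarrow> ('m \<Rightarrow> 'v \<Rightarrow> 'v) \<Rightarrow> ('m \<Rightarrow> 'm tangent \<Rightarrow> real)
     \<Rightarrow> ('m \<Rightarrow> 'v \<Rightarrow> 'v) \<Rightarrow> bool"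
where
  "cov_End_eq_tensor A r E D U J \<alpha> N \<longleftrightarrow>
     (\<forall>W x s. open W \<and> W \<subseteq> U \<and> x \<in> W \<and> smooth_section A r E W s \<longrightarrow>
        (\<forall>v\<in>tangent_space A x. cov_End D J x v s = \<alpha> x v *\<^sub>R N x (s x)))"


section \<open>Nilpotent and paracomplex structures\<close>

text \<open>Signs are the real numbers 1 and -1.  The matrix \<open>I'\<close> with blocks
  \<open>I\<^sub>n, I\<^sub>n, I\<^sub>n, diag (\<epsilon>, 1, \<dots>, 1)\<close> on the diagonal:\<close>

definition I_prime :: "nat \<Rightarrow> real \<Rightarrow> nat \<Rightarrow> nat \<Rightarrow> real"
where
  "I_prime n \<epsilon> i j = (if i \<noteq> j then 0 else if i = 3 * n + 1 then \<epsilon> else 1)"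

text \<open>The block matrix whose \<open>(p, q)\<close> block is the multiple \<open>C ! p ! q\<close> of the
  \<open>n \<times> n\<close> unit matrix.\<close>

definition block_matrix :: "nat \<Rightarrow> real list list \<Rightarrow> nat \<Rightarrow> nat \<Rightarrow> real"
where
  "block_matrix n C i j =
     (if (i - 1) mod n = (j - 1) mod n then C ! ((i - 1) div n) ! ((j - 1) div n) else 0)"

definition Lambda_matrix :: "nat \<Rightarrow> nat \<Rightarrow> nat \<Rightarrow> real"
where
  "Lambda_matrix n = block_matrix n
     [[0, -1, 0,  1],
      [1,  0, 1,  0],
      [0,  1, 0, -1],
      [1,  0, 1,  0]]"

definition paracomplex_matrix :: "nat \<Rightarrow> nat \<Rightarrow> nat \<Rightarrow> real"
where
  "paracomplex_matrix n = block_matrix n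
     [[0,  0, 1,  0],
      [0,  0, 0, -1],
      [1,  0, 0,  0],
      [0, -1, 0,  0]]"

text \<open>The row of sections \<open>e P\<close>.\<close>

definition frame_mult ::
  "nat \<Rightarrow> (nat \<Rightarrow> 'm \<Rightarrow> 'v::real_vector) \<Rightarrow> (nat \<Rightarrow> nat \<Rightarrow> real) \<Rightarrow> nat \<Rightarrow> 'm \<Rightarrow> 'v"
where
  "frame_mult r e P j x = (\<Sum>i\<in>{1..r}. P i j *\<^sub>R e i x)"

definition oriented_orthonormal_frame ::
  "('m::topological_space, 'b::real_normed_vector) atlas \<Rightarrow> nat \<Rightarrow> ('m, 'v::real_vector) vbundle
     \<Rightarrow> ('m \<Rightarrow> (nat \<Rightarrow> 'v) set) \<Rightarrow> ('m \<Rightarrow> 'v \<Rightarrow> 'v \<Rightarrow> real) \<Rightarrow> 'm set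
     \<Rightarrow> (nat \<Rightarrow> 'm \<Rightarrow> 'v) \<Rightarrow> bool"
where
  "oriented_orthonormal_frame A n E ori h U e \<longleftrightarrow>
     local_frame A (4 * n) E U e \<and>
     (\<forall>x\<in>U. pseudo_orthonormal (4 * n) (2 * n) (h x) (\<lambda>i. e i x) \<and> (\<lambda>i. e i x) \<in> ori x)"

definition acts_by_matrix ::
  "nat \<Rightarrow> real \<Rightarrow> (nat \<Rightarrow> nat \<Rightarrow> real) \<Rightarrow> 'm set \<Rightarrow> (nat \<Rightarrow> 'm \<Rightarrow> 'v::real_vector)
     \<Rightarrow> ('m \<Rightarrow> 'v \<Rightarrow> 'v) \<Rightarrow> bool"
where
  "acts_by_matrix n \<epsilon> P U e N \<longleftrightarrow>
     (let f = frame_mult (4 * n) e (I_prime n \<epsilon>)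
      in \<forall>x\<in>U. \<forall>j\<in>{1..4 * n}. N x (f j x) = frame_mult (4 * n) f P j x)"

definition nilpotent_admissible ::
  "('m::topological_space, 'b::real_normed_vector) atlas \<Rightarrow> nat \<Rightarrow> ('m, 'v::real_vector) vbundle
     \<Rightarrow> ('m \<Rightarrow> (nat \<Rightarrow> 'v) set) \<Rightarrow> ('m \<Rightarrow> 'v \<Rightarrow> 'v \<Rightarrow> real) \<Rightarrow> real \<Rightarrow> ('m \<Rightarrow> 'v \<Rightarrow> 'v)
     \<Rightarrow> 'm set \<Rightarrow> (nat \<Rightarrow> 'm \<Rightarrow> 'v) \<Rightarrow> bool"
where
  "nilpotent_admissible A n E ori h \<epsilon> N U e \<longleftrightarrow>
     oriented_orthonormal_frame A n E ori h U e \<and> acts_by_matrix n \<epsilon> (Lambda_matrix n) U e N"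

text \<open>An \<open>\<epsilon>\<close>-nilpotent structure of the restriction of \<open>E\<close> to \<open>U\<close>.\<close>

definition nilpotent_structure ::
  "('m::topological_space, 'b::real_normed_vector) atlas \<Rightarrow> nat \<Rightarrow> ('m, 'v::real_vector) vbundle
     \<Rightarrow> ('m \<Rightarrow> (nat \<Rightarrow> 'v) set) \<Rightarrow> ('m \<Rightarrow> 'v \<Rightarrow> 'v \<Rightarrow> real) \<Rightarrow> real \<Rightarrow> 'm set
     \<Rightarrow> ('m \<Rightarrow> 'v \<Rightarrow> 'v) \<Rightarrow> bool"
where
  "nilpotent_structure A n E ori h \<epsilon> U N \<longleftrightarrow>
     End_section A (4 * n) E U N \<and>
     (\<forall>x\<in>U. \<exists>W e. x \<in> W \<and> W \<subseteq> U \<and> nilpotent_admissible A n E ori h \<epsilon> N W e)"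

definition paracomplex_admissible ::
  "('m::topological_space, 'b::real_normed_vector) atlas \<Rightarrow> nat \<Rightarrow> ('m, 'v::real_vector) vbundle
     \<Rightarrow> ('m \<Rightarrow> (nat \<Rightarrow> 'v) set) \<Rightarrow> ('m \<Rightarrow> 'v \<Rightarrow> 'v \<Rightarrow> real) \<Rightarrow> real \<Rightarrow> ('m \<Rightarrow> 'v \<Rightarrow> 'v)
     \<Rightarrow> 'm set \<Rightarrow> (nat \<Rightarrow> 'm \<Rightarrow> 'v) \<Rightarrow> bool"
where
  "paracomplex_admissible A n E ori h \<epsilon> J U e \<longleftrightarrow>
     oriented_orthonormal_frame A n E ori h U e \<and> acts_by_matrix n \<epsilon> (paracomplex_matrix n) U e J"

definition paracomplex_structure ::
  "('m::topological_space, 'b::real_normed_vector) atlas \<Rightarrow> nat \<Rightarrow> ('m, 'v::real_vector) vbundle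
     \<Rightarrow> ('m \<Rightarrow> (nat \<Rightarrow> 'v) set) \<Rightarrow> ('m \<Rightarrow> 'v \<Rightarrow> 'v \<Rightarrow> real) \<Rightarrow> real
     \<Rightarrow> ('m \<Rightarrow> 'v \<Rightarrow> 'v) \<Rightarrow> bool"
where
  "paracomplex_structure A n E ori h \<epsilon> J \<longleftrightarrow>
     End_section A (4 * n) E UNIV J \<and>
     (\<forall>x. \<forall>u\<in>fibre E x. J x (J x u) = u) \<and>
     (\<forall>x. dim {u \<in> fibre E x. J x u = u} = dim {u \<in> fibre E x. J x u = - u}) \<and>
     (\<forall>x. \<forall>u\<in>fibre E x. \<forall>w\<in>fibre E x. h x (J x u) (J x w) = - h x u w) \<and>
     (\<forall>x. \<exists>W e. x \<in> W \<and> paracomplex_admissible A n E ori h \<epsilon> J W e)"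

text \<open>The frame \<open>e(\<mu>)\<close>.\<close>

definition frame_sign :: "nat \<Rightarrow> (nat \<Rightarrow> 'm \<Rightarrow> 'v::real_vector) \<Rightarrow> real \<Rightarrow> nat \<Rightarrow> 'm \<Rightarrow> 'v"
where
  "frame_sign n e \<mu> i x = (if i \<le> 2 * n then e i x else \<mu> *\<^sub>R e i x)"

definition related_by ::
  "('m::topological_space, 'b::real_normed_vector) atlas \<Rightarrow> nat \<Rightarrow> ('m, 'v::real_vector) vbundle
     \<Rightarrow> ('m \<Rightarrow> (nat \<Rightarrow> 'v) set) \<Rightarrow> ('m \<Rightarrow> 'v \<Rightarrow> 'v \<Rightarrow> real) \<Rightarrow> real \<Rightarrow> ('m \<Rightarrow> 'v \<Rightarrow> 'v)
     \<Rightarrow> ('m \<Rightarrow> 'v \<Rightarrow> 'v) \<Rightarrow> 'm set \<Rightarrow> (nat \<Rightarrow> 'm \<Rightarrow> 'v) \<Rightarrow> real \<Rightarrow> bool"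
where
  "related_by A n E ori h \<epsilon> N J U e \<mu> \<longleftrightarrow>
     paracomplex_admissible A n E ori h \<epsilon> J U e \<and>
     nilpotent_admissible A n E ori h \<epsilon> N U (frame_sign n e \<mu>)"

definition kdelta :: "nat \<Rightarrow> nat \<Rightarrow> nat"
where
  "kdelta i j = (if i = j then 1 else 0)"

end

theory Submission imports Defs begin

text \<open>
  Write \<open>f = eI'\<close> and let \<open>W\<close> be the connection form with respect to \<open>f\<close>, so
  \<open>W\<^sup>i\<^sub>j\<close> is \<open>\<omega>\<^sup>i\<^sub>j\<close> up to the signs in \<open>I'\<close>.  In the frame \<open>f\<close> the endomorphism \<open>J\<close> has a
  constant matrix \<open>P\<close>, hence \<open>\<nabla>J\<close> has the matrix \<open>WP - PW\<close>; the structure \<open>N\<close> with admissible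
  frame \<open>e(\<mu>)\<close> has the matrix \<open>S\<Lambda>S\<close> with \<open>S = diag(I, I, \<mu>I, \<mu>I)\<close>.  So (a) says
  \<open>WP - PW = \<alpha>S\<Lambda>S\<close>, and such an \<open>N\<close> always exists: it is the endomorphism with this matrix.
  Of the sixteen blocks of this equation eight are repetitions; two more follow from the others
  because \<open>\<nabla>h = 0\<close> makes \<open>W\<close> skew with respect to \<open>h\<close>.  What remains is (b).
\<close>


subsection \<open>Smooth functions\<close>

text \<open>The derivatives in \<open>Ck_on\<close> are taken at \<open>x\<close> in the whole space
  and do not depend on the set, which only says where continuity and differentiability are
  tested.\<close>

lemma Ck_on_subset:
  assumes "Ck_on k S f" "T \<subseteq> S"
  shows "Ck_on k T f"
  using assms(1)
proof (induction k arbitrary: f)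
  case 0
  then show ?case using continuous_on_subset assms(2) unfolding Ck_on.simps by blast
next
  case (Suc k)
  then show ?case using differentiable_on_subset[OF _ assms(2)] unfolding Ck_on.simps by blast
qed

text \<open>Serves the product rule, in which each factor also occurs undifferentiated and has to be
  regarded as a function of the next lower class.\<close>

lemma Ck_on_SucD: "Ck_on (Suc k) S f \<Longrightarrow> Ck_on k S f"
proof (induction k arbitrary: f)
  case 0
  then show ?case by (simp add: differentiable_imp_continuous_on)
next
  case (Suc k)
  from Suc.prems have "f differentiable_on S"
    and "\<And>v. Ck_on (Suc k) S (\<lambda>x. frechet_derivative f (at x) v)"
    unfolding Ck_on.simps(2)[of "Suc k"] by blast+
  with Suc.IH show ?case unfolding Ck_on.simps(2) by blast
qed

text \<open>Openness of \<open>S\<close> turns equality on \<open>S\<close> into equality near each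
  of its points, which is what \<open>frechet_derivative\<close> depends on.\<close>

lemma Ck_on_cong:
  assumes "open S" "Ck_on k S f" "\<And>x. x \<in> S \<Longrightarrow> f x = g x"
  shows "Ck_on k S g"
  using assms(2,3)
proof (induction k arbitrary: f g)
  case 0
  then show ?case by (metis Ck_on.simps(1) continuous_on_cong)
next
  case (Suc k)
  have f: "f differentiable (at x)" if "x \<in> S" for x
    using Suc.prems that assms(1) by (auto simp: differentiable_on_eq_differentiable_at)
  have "frechet_derivative f (at x) = frechet_derivative g (at x)" if "x \<in> S" for x
    using frechet_derivative_transform_within_open[OF f[OF that] assms(1) that] Suc.prems by blast
  then have "Ck_on k S (\<lambda>x. frechet_derivative g (at x) v)" for v
    using Suc.IH[of "\<lambda>x. frechet_derivative f (at x) v" "\<lambda>x. frechet_derivative g (at x) v"] Suc.prems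
    by simp
  moreover have "g differentiable (at x)" if "x \<in> S" for x
    using f[OF that] has_derivative_transform_within_open[OF _ assms(1) that] Suc.prems(2)
    unfolding differentiable_def by blast
  then have "g differentiable_on S"
    by (simp add: differentiable_at_imp_differentiable_on)
  ultimately show ?case by simp
qed

lemma Ck_on_const: "Ck_on k S (\<lambda>x. c)"
  by (induction k arbitrary: c) (auto simp: frechet_derivative_const)

lemma Ck_on_add:
  assumes "open S" "Ck_on k S f" "Ck_on k S g"
  shows "Ck_on k S (\<lambda>x. f x + g x)"
  using assms(2,3)
proof (induction k arbitrary: f g)
  case 0
  then show ?case by (simp add: continuous_on_add)
next
  case (Suc k)
  have df: "f differentiable (at x)" and dg: "g differentiable (at x)" if "x \<in> S" for x
    using Suc.prems that assms(1) by (auto simp: differentiable_on_eq_differentiable_at)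
  have "Ck_on k S (\<lambda>x. frechet_derivative (\<lambda>x. f x + g x) (at x) v)" for v
  \<comment> \<open>The sum rule for \<open>frechet_derivative\<close> is known only where both
    functions are differentiable, that is on \<open>S\<close>; hence the detour through a
    congruence.\<close>
  proof (rule Ck_on_cong[OF assms(1)])
    show "Ck_on k S (\<lambda>x. frechet_derivative f (at x) v + frechet_derivative g (at x) v)"
      using Suc by simp
    show "frechet_derivative f (at x) v + frechet_derivative g (at x) v
        = frechet_derivative (\<lambda>x. f x + g x) (at x) v" if "x \<in> S" for x
      using fun_cong[OF frechet_derivative_at[OF has_derivative_add[OF
              df[OF that, unfolded frechet_derivative_works] dg[OF that, unfolded frechet_derivative_works]]]] .
  qed
  moreover have "(\<lambda>x. f x + g x) differentiable_on S"
    using Suc.prems unfolding Ck_on.simps by (intro differentiable_on_add) blast+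
  ultimately show ?case unfolding Ck_on.simps by blast
qed

lemma Ck_on_mult:
  fixes f g :: "'a::real_normed_vector \<Rightarrow> real"
  assumes "open S" "Ck_on k S f" "Ck_on k S g"
  shows "Ck_on k S (\<lambda>x. f x * g x)"
  using assms(2,3)
proof (induction k arbitrary: f g)
  case 0
  then show ?case by (simp add: continuous_on_mult)
next
  case (Suc k)
  have df: "f differentiable (at x)" and dg: "g differentiable (at x)" if "x \<in> S" for x
    using Suc.prems that assms(1) by (auto simp: differentiable_on_eq_differentiable_at)
  have "Ck_on k S (\<lambda>x. frechet_derivative (\<lambda>x. f x * g x) (at x) v)" for v
  proof (rule Ck_on_cong[OF assms(1)])
    show "Ck_on k S (\<lambda>x. f x * frechet_derivative g (at x) v + frechet_derivative f (at x) v * g x)"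
      using Suc Ck_on_SucD[OF Suc.prems(1)] Ck_on_SucD[OF Suc.prems(2)]
      by (intro Ck_on_add assms(1)) auto
    show "f x * frechet_derivative g (at x) v + frechet_derivative f (at x) v * g x
        = frechet_derivative (\<lambda>x. f x * g x) (at x) v" if "x \<in> S" for x
      using fun_cong[OF frechet_derivative_at[OF has_derivative_mult[OF
              df[OF that, unfolded frechet_derivative_works] dg[OF that, unfolded frechet_derivative_works]]]] .
  qed
  moreover have "(\<lambda>x. f x * g x) differentiable_on S"
    using Suc.prems unfolding Ck_on.simps by (intro differentiable_on_mult) blast+
  ultimately show ?case unfolding Ck_on.simps by blast
qed

section \<open>Smooth functions on a manifold\<close>

lemma chart_image_open:
  assumes "smooth_manifold A" "(V, \<phi>) \<in> A" "open W"
  shows "open (\<phi> ` (V \<inter> W))"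
proof -
  have "\<forall>(V, \<phi>)\<in>A. open V \<and> open (\<phi> ` V) \<and> (\<exists>\<psi>. homeomorphism V (\<phi> ` V) \<phi> \<psi>)"
    using assms(1) unfolding smooth_manifold_def by (elim conjE)
  from bspec[OF this assms(2)] have "open (\<phi> ` V)" and "\<exists>\<psi>. homeomorphism V (\<phi> ` V) \<phi> \<psi>"
    by simp_all
  then obtain \<psi> where "homeomorphism V (\<phi> ` V) \<phi> \<psi>" by blast
  moreover have "openin (top_of_set V) (V \<inter> W)"
    using assms(3) by (rule openin_open_Int)
  \<comment> \<open>Relative openness suffices because the image of the chart is itself open. The
    result supplies the open domains that the sum and product rules for \<open>Ck_on\<close>
    require.\<close>
  ultimately have "openin (top_of_set (\<phi> ` V)) (\<phi> ` (V \<inter> W))"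
    by (rule homeomorphism_imp_open_map)
  then show ?thesis using \<open>open (\<phi> ` V)\<close> by (rule openin_open_trans)
qed

lemma smooth_fun_subset:
  assumes "smooth_fun A W f" "W' \<subseteq> W"
  shows "smooth_fun A W' f"
  unfolding smooth_fun_def smooth_on_def
proof (intro ballI, clarify)
  fix V \<phi> k assume "(V, \<phi>) \<in> A"
  with assms(1) have "Ck_on k (\<phi> ` (V \<inter> W)) (f \<circ> inv_into V \<phi>)"
    by (auto simp: smooth_fun_def smooth_on_def)
  then show "Ck_on k (\<phi> ` (V \<inter> W')) (f \<circ> inv_into V \<phi>)"
    by (rule Ck_on_subset) (use assms(2) in blast)
qed

lemma smooth_fun_const: "smooth_fun A W (\<lambda>x. c)"
  unfolding smooth_fun_def smooth_on_def by (auto simp: comp_def Ck_on_const)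

lemma smooth_fun_add:
  assumes "smooth_manifold A" "open W" "smooth_fun A W f" "smooth_fun A W g"
  shows "smooth_fun A W (\<lambda>x. f x + g x)"
  unfolding smooth_fun_def smooth_on_def
proof (intro ballI, clarify)
  fix V \<phi> k assume V: "(V, \<phi>) \<in> A"
  with assms(3,4) have "Ck_on k (\<phi> ` (V \<inter> W)) (f \<circ> inv_into V \<phi>)"
    and "Ck_on k (\<phi> ` (V \<inter> W)) (g \<circ> inv_into V \<phi>)"
    by (auto simp: smooth_fun_def smooth_on_def)
  from Ck_on_add[OF chart_image_open[OF assms(1) V assms(2)] this]
  show "Ck_on k (\<phi> ` (V \<inter> W)) ((\<lambda>x. f x + g x) \<circ> inv_into V \<phi>)"
    by (simp add: comp_def)
qed

lemma smooth_fun_mult: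
  assumes "smooth_manifold A" "open W" "smooth_fun A W f" "smooth_fun A W g"
  shows "smooth_fun A W (\<lambda>x. f x * g x)"
  unfolding smooth_fun_def smooth_on_def
proof (intro ballI, clarify)
  fix V \<phi> k assume V: "(V, \<phi>) \<in> A"
  with assms(3,4) have "Ck_on k (\<phi> ` (V \<inter> W)) (f \<circ> inv_into V \<phi>)"
    and "Ck_on k (\<phi> ` (V \<inter> W)) (g \<circ> inv_into V \<phi>)"
    by (auto simp: smooth_fun_def smooth_on_def)
  from Ck_on_mult[OF chart_image_open[OF assms(1) V assms(2)] this]
  show "Ck_on k (\<phi> ` (V \<inter> W)) ((\<lambda>x. f x * g x) \<circ> inv_into V \<phi>)"
    by (simp add: comp_def)
qed

section \<open>Tangent vectors as derivations\<close>

lemma tangent_cong: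
  assumes "v \<in> tangent_space A x" "open W" "x \<in> W" "\<And>y. y \<in> W \<Longrightarrow> f y = g y"
  shows "v f = v g"
proof -
  have "\<forall>f g W. open W \<and> x \<in> W \<and> (\<forall>y\<in>W. f y = g y) \<longrightarrow> v f = v g"
    using assms(1) unfolding tangent_space_def mem_Collect_eq by (elim conjE)
  from this[rule_format, of W f g] assms(2-4) show ?thesis by simp
qed

text \<open>The Leibniz rule for \<open>1 * 1\<close> gives \<open>v 1 = 2 * v 1\<close>, so
  \<open>v 1 = 0\<close>, and homogeneity does the rest.\<close>

lemma tangent_const:
  assumes "v \<in> tangent_space A x"
  shows "v (\<lambda>y. c) = 0"
proof -
  have "\<forall>f g W. open W \<and> x \<in> W \<and> smooth_fun A W f \<and> smooth_fun A W g \<longrightarrow>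
        v (\<lambda>y. f y + g y) = v f + v g \<and> (\<forall>c. v (\<lambda>y. c * f y) = c * v f) \<and>
        v (\<lambda>y. f y * g y) = v f * g x + f x * v g"
    using assms unfolding tangent_space_def mem_Collect_eq by (rule conjunct2[OF conjunct2])
  from this[rule_format, of UNIV "\<lambda>y. 1" "\<lambda>y. 1"] smooth_fun_const[of A UNIV 1]
  have "v (\<lambda>y. 1 * 1) = v (\<lambda>y. 1) * 1 + 1 * v (\<lambda>y. 1)" and "v (\<lambda>y. c * 1) = c * v (\<lambda>y. 1)"
    by (blast intro: open_UNIV)+
  then show ?thesis by simp
qed

subsection \<open>Sections and connections\<close>

text \<open>The type of bundles leaves \<open>fibre\<close> an arbitrary set; it is a subspace
  because a trivialising frame near \<open>x\<close> spans it.\<close>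

lemma vector_bundle_subspace:
  assumes "vector_bundle A r E"
  shows "subspace (fibre E x)"
proof -
  have "x \<in> (\<Union>(V, b)\<in>trivs E. V)" using assms by (simp add: vector_bundle_def)
  then obtain V b where "(V, b) \<in> trivs E" "x \<in> V" by blast
  then have "ordered_basis r (fibre E x) (\<lambda>i. b i x)"
    using assms unfolding vector_bundle_def local_frame_def by fastforce
  then show ?thesis unfolding ordered_basis_def by (metis subspace_span)
qed

lemma smooth_section_fibre: "smooth_section A r E W s \<Longrightarrow> x \<in> W \<Longrightarrow> s x \<in> fibre E x"
  by (simp add: smooth_section_def)

lemma smooth_sectionE:
  assumes "smooth_section A r E W s" "(V, b) \<in> trivs E"
  obtains c where "\<And>i. i \<in> {1..r} \<Longrightarrow> smooth_fun A (V \<inter> W) (c i)"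
    "\<And>x. x \<in> V \<inter> W \<Longrightarrow> s x = (\<Sum>i\<in>{1..r}. c i x *\<^sub>R b i x)"
  using assms unfolding smooth_section_def by fastforce

lemma smooth_section_subset:
  assumes "smooth_section A r E W s" "W' \<subseteq> W"
  shows "smooth_section A r E W' s"
  unfolding smooth_section_def
proof (intro conjI ballI, goal_cases)
  case (1 x)
  then show ?case using assms by (auto simp: smooth_section_def)
next
  case (2 p)
  obtain V b where p: "p = (V, b)" and Vb: "(V, b) \<in> trivs E" using 2 by (cases p) auto
  obtain c where c: "\<And>i. i \<in> {1..r} \<Longrightarrow> smooth_fun A (V \<inter> W) (c i)"
    "\<And>x. x \<in> V \<inter> W \<Longrightarrow> s x = (\<Sum>i\<in>{1..r}. c i x *\<^sub>R b i x)"
    using smooth_sectionE[OF assms(1) Vb] by blast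
  have "smooth_fun A (V \<inter> W') (c i)" if "i \<in> {1..r}" for i
    using smooth_fun_subset[OF c(1)[OF that]] assms(2) by blast
  then show ?case
    unfolding p prod.case using c(2) assms(2) by (intro exI[of _ c]) blast
qed

locale smooth_vector_bundle =
  fixes A :: "('m::{t2_space,second_countable_topology}, 'b::real_normed_vector) atlas"
    and r :: nat and E :: "('m, 'v::real_vector) vbundle"
  assumes manifold: "smooth_manifold A" and vbundle: "vector_bundle A r E"
begin

lemma subspace_fibre: "subspace (fibre E x)"
  by (rule vector_bundle_subspace[OF vbundle])

lemma triv_open: "(V, b) \<in> trivs E \<Longrightarrow> open V"
  using vbundle unfolding vector_bundle_def local_frame_def by fastforce

section \<open>Linear operations on smooth sections\<close>

lemma smooth_section_zero: "smooth_section A r E W (\<lambda>x. 0)"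
  unfolding smooth_section_def
  using smooth_fun_const[of A _ 0] subspace_0[OF subspace_fibre]
  by (force intro!: exI[of _ "\<lambda>i x. 0"])

lemma smooth_section_scaleR:
  assumes "open W" "smooth_fun A W f" "smooth_section A r E W s"
  shows "smooth_section A r E W (\<lambda>x. f x *\<^sub>R s x)"
  unfolding smooth_section_def
proof (intro conjI ballI, goal_cases)
  case (1 x)
  then show ?case using assms by (auto simp: smooth_section_def subspace_scale[OF subspace_fibre])
next
  case (2 p)
  obtain V b where p: "p = (V, b)" and Vb: "(V, b) \<in> trivs E" using 2 by (cases p) auto
  obtain c where c: "\<And>i. i \<in> {1..r} \<Longrightarrow> smooth_fun A (V \<inter> W) (c i)"
    "\<And>x. x \<in> V \<inter> W \<Longrightarrow> s x = (\<Sum>i\<in>{1..r}. c i x *\<^sub>R b i x)"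
    using smooth_sectionE[OF assms(3) Vb] by blast
  have "smooth_fun A (V \<inter> W) (\<lambda>x. f x * c i x)" if "i \<in> {1..r}" for i
    using smooth_fun_mult[OF manifold open_Int[OF triv_open[OF Vb] assms(1)]
        smooth_fun_subset[OF assms(2)] c(1)[OF that]] by simp
  then show ?case
    unfolding p by (auto simp: c(2) scaleR_sum_right intro!: exI[of _ "\<lambda>i x. f x * c i x"])
qed

lemma smooth_section_add:
  assumes "open W" "smooth_section A r E W s" "smooth_section A r E W t"
  shows "smooth_section A r E W (\<lambda>x. s x + t x)"
  unfolding smooth_section_def
proof (intro conjI ballI, goal_cases)
  case (1 x)
  then show ?case using assms by (auto simp: smooth_section_def subspace_add[OF subspace_fibre])
next
  case (2 p)
  obtain V b where p: "p = (V, b)" and Vb: "(V, b) \<in> trivs E" using 2 by (cases p) auto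
  obtain c where c: "\<And>i. i \<in> {1..r} \<Longrightarrow> smooth_fun A (V \<inter> W) (c i)"
    "\<And>x. x \<in> V \<inter> W \<Longrightarrow> s x = (\<Sum>i\<in>{1..r}. c i x *\<^sub>R b i x)"
    using smooth_sectionE[OF assms(2) Vb] by blast
  obtain d where d: "\<And>i. i \<in> {1..r} \<Longrightarrow> smooth_fun A (V \<inter> W) (d i)"
    "\<And>x. x \<in> V \<inter> W \<Longrightarrow> t x = (\<Sum>i\<in>{1..r}. d i x *\<^sub>R b i x)"
    using smooth_sectionE[OF assms(3) Vb] by blast
  have "smooth_fun A (V \<inter> W) (\<lambda>x. c i x + d i x)" if "i \<in> {1..r}" for i
    using smooth_fun_add[OF manifold open_Int[OF triv_open[OF Vb] assms(1)] c(1)[OF that] d(1)[OF that]] .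
  then show ?case
    unfolding p by (auto simp: c(2) d(2) scaleR_add_left sum.distrib intro!: exI[of _ "\<lambda>i x. c i x + d i x"])
qed

lemma smooth_section_sum:
  assumes "open W" "\<And>i. i \<in> I \<Longrightarrow> smooth_section A r E W (s i)"
  shows "smooth_section A r E W (\<lambda>x. \<Sum>i\<in>I. s i x)"
  using assms(2)
  by (induction I rule: infinite_finite_induct) (simp_all add: smooth_section_zero smooth_section_add assms(1))

lemma smooth_section_linear_combination:
  assumes "open W" "\<And>i. i \<in> I \<Longrightarrow> smooth_fun A W (c i)" "\<And>i. i \<in> I \<Longrightarrow> smooth_section A r E W (s i)"
  shows "smooth_section A r E W (\<lambda>x. \<Sum>i\<in>I. c i x *\<^sub>R s i x)"
  using assms by (intro smooth_section_sum smooth_section_scaleR)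

section \<open>Sections of the endomorphism bundle\<close>

lemma End_section_linear:
  assumes "End_section A r E U J" "x \<in> U" "u \<in> fibre E x" "w \<in> fibre E x"
  shows "J x u \<in> fibre E x" "J x (u + w) = J x u + J x w" "J x (c *\<^sub>R u) = c *\<^sub>R J x u"
  using conjunct1[OF assms(1)[unfolded End_section_def], THEN bspec[OF _ assms(2)],
      THEN bspec[OF _ assms(3)], THEN bspec[OF _ assms(4)]] by simp_all

lemma End_section_smooth:
  assumes "End_section A r E U J" "open W" "W \<subseteq> U" "smooth_section A r E W s"
  shows "smooth_section A r E W (\<lambda>x. J x (s x))"
  using conjunct2[OF assms(1)[unfolded End_section_def]] assms(2-4) by simp

text \<open>An \<open>End_section\<close> is linear only on the fibre and arbitrary outside it, so
  the induction has to check that every partial sum lies in the fibre.\<close>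

lemma End_section_sum:
  assumes J: "End_section A r E U J" "x \<in> U" and "\<And>i. i \<in> I \<Longrightarrow> u i \<in> fibre E x"
  shows "J x (\<Sum>i\<in>I. a i *\<^sub>R u i) = (\<Sum>i\<in>I. a i *\<^sub>R J x (u i))"
proof -
  have zero: "J x 0 = 0"
    using End_section_linear(3)[OF J, of 0 0 0] subspace_0[OF subspace_fibre[of x]] by simp
  show ?thesis using assms(3)
  proof (induction I rule: infinite_finite_induct)
    case (insert i I)
    then have "(\<Sum>i\<in>I. a i *\<^sub>R u i) \<in> fibre E x" "u i \<in> fibre E x" "a i *\<^sub>R u i \<in> fibre E x"
      by (auto intro!: subspace_sum subspace_scale subspace_fibre)
    with insert show ?case
      by (simp add: End_section_linear(2,3)[OF J])
  qed (simp_all add: zero)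
qed

section \<open>Covariant derivatives of linear combinations\<close>

lemma connection_fibre:
  assumes "connection A r E D" "v \<in> tangent_space A x" "open W" "x \<in> W" "smooth_section A r E W s"
  shows "D x v s \<in> fibre E x"
proof -
  note conjunct1[OF assms(1)[unfolded connection_def], rule_format, of W x s v v 0]
  with assms show ?thesis by simp
qed

text \<open>The definition of a connection states these three rules for a pair of sections at once,
  so the Leibniz rule too carries a second section \<open>t\<close>; its applications take
  \<open>t\<close> equal to \<open>s\<close>.\<close>

lemma
  assumes "connection A r E D" "v \<in> tangent_space A x" "open W" "x \<in> W"
    "smooth_section A r E W s" "smooth_section A r E W t"
  shows connection_add: "D x v (\<lambda>y. s y + t y) = D x v s + D x v t"
    and connection_cong: "(\<And>y. y \<in> W \<Longrightarrow> s y = t y) \<Longrightarrow> D x v s = D x v t"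
    and connection_Leibniz: "smooth_fun A W f \<Longrightarrow>
      D x v (\<lambda>y. f y *\<^sub>R s y) = v f *\<^sub>R s x + f x *\<^sub>R D x v s"
proof -
  note * = conjunct1[OF conjunct2[OF assms(1)[unfolded connection_def]], THEN spec[of _ W],
      THEN spec[of _ x], THEN spec[of _ s], THEN spec[of _ t], THEN mp, THEN bspec[OF _ assms(2)],
      OF conjI[OF assms(3) conjI[OF assms(4) conjI[OF assms(5,6)]]]]
  show "D x v (\<lambda>y. s y + t y) = D x v s + D x v t"
    using * by (elim conjE)
  show "D x v s = D x v t" if "\<And>y. y \<in> W \<Longrightarrow> s y = t y"
    using conjunct1[OF conjunct2[OF *]] that by simp
  show "D x v (\<lambda>y. f y *\<^sub>R s y) = v f *\<^sub>R s x + f x *\<^sub>R D x v s" if "smooth_fun A W f"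
    using conjunct2[OF conjunct2[OF *], THEN spec[of _ f]] that by simp
qed

lemma connection_linear_combination:
  assumes D: "connection A r E D" "v \<in> tangent_space A x" and W: "open W" "x \<in> W"
    and sm: "\<And>i. i \<in> I \<Longrightarrow> smooth_fun A W (c i)" "\<And>i. i \<in> I \<Longrightarrow> smooth_section A r E W (s i)"
  shows "D x v (\<lambda>y. \<Sum>i\<in>I. c i y *\<^sub>R s i y) = (\<Sum>i\<in>I. v (c i) *\<^sub>R s i x + c i x *\<^sub>R D x v (s i))"
  using sm
proof (induction I rule: infinite_finite_induct)
  case (insert i I)
  have "D x v (\<lambda>y. \<Sum>i\<in>insert i I. c i y *\<^sub>R s i y)
      = D x v (\<lambda>y. c i y *\<^sub>R s i y + (\<Sum>i\<in>I. c i y *\<^sub>R s i y))"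
    using insert by simp
  also have "\<dots> = D x v (\<lambda>y. c i y *\<^sub>R s i y) + D x v (\<lambda>y. \<Sum>i\<in>I. c i y *\<^sub>R s i y)"
    using insert.prems by (intro connection_add[OF D W] smooth_section_linear_combination
        smooth_section_scaleR W) auto
  finally show ?case
    using insert connection_Leibniz[OF D W, of "s i" "s i" "c i"] by simp
\<comment> \<open>Empty and infinite sums are the zero section, whose derivative vanishes because
  \<open>0 + 0 = 0\<close>.\<close>
qed (use connection_add[OF D W smooth_section_zero smooth_section_zero] in simp_all)

text \<open>Tensoriality of \<nabla>J: the terms with \<open>v (c i)\<close> produced by the Leibniz
  rule occur both in \<nabla>(Js) and in J(\<nabla>s), and cancel. Hence \<nabla>J is determined by
  its values on a frame.\<close>

lemma cov_End_linear_combination: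
  assumes D: "connection A r E D" "v \<in> tangent_space A x" and W: "open W" "x \<in> W" "W \<subseteq> U"
    and J: "End_section A r E U J"
    and sm: "\<And>i. i \<in> I \<Longrightarrow> smooth_fun A W (c i)" "\<And>i. i \<in> I \<Longrightarrow> smooth_section A r E W (s i)"
  shows "cov_End D J x v (\<lambda>y. \<Sum>i\<in>I. c i y *\<^sub>R s i y) = (\<Sum>i\<in>I. c i x *\<^sub>R cov_End D J x v (s i))"
proof -
  have Js: "smooth_section A r E W (\<lambda>y. J y (s i y))" if "i \<in> I" for i
    using End_section_smooth[OF J W(1,3) sm(2)[OF that]] .
  have fib: "s i y \<in> fibre E y" if "i \<in> I" "y \<in> W" for i y
    using sm that by (auto simp: smooth_section_def)
  have x: "x \<in> U" using W by auto
  have "D x v (\<lambda>y. J y (\<Sum>i\<in>I. c i y *\<^sub>R s i y)) = D x v (\<lambda>y. \<Sum>i\<in>I. c i y *\<^sub>R J y (s i y))"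
  proof (rule connection_cong[OF D W(1,2)])
    show "smooth_section A r E W (\<lambda>y. \<Sum>i\<in>I. c i y *\<^sub>R J y (s i y))"
      using Js sm W by (intro smooth_section_linear_combination)
    show "smooth_section A r E W (\<lambda>y. J y (\<Sum>i\<in>I. c i y *\<^sub>R s i y))"
      using sm W by (intro End_section_smooth[OF J] smooth_section_linear_combination)
    show "J y (\<Sum>i\<in>I. c i y *\<^sub>R s i y) = (\<Sum>i\<in>I. c i y *\<^sub>R J y (s i y))" if "y \<in> W" for y
      using End_section_sum[OF J, of y I "\<lambda>i. s i y" "\<lambda>i. c i y"] fib that W by auto
  qed
  also have "\<dots> = (\<Sum>i\<in>I. v (c i) *\<^sub>R J x (s i x)) + (\<Sum>i\<in>I. c i x *\<^sub>R D x v (\<lambda>y. J y (s i y)))"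
    using connection_linear_combination[OF D W(1,2) sm(1) Js] by (simp add: sum.distrib)
  finally have 1: "D x v (\<lambda>y. J y (\<Sum>i\<in>I. c i y *\<^sub>R s i y)) = \<dots>" .
  have DF: "D x v (s i) \<in> fibre E x" if "i \<in> I" for i
    using connection_fibre[OF D W(1,2) sm(2)[OF that]] .
  have "J x (D x v (\<lambda>y. \<Sum>i\<in>I. c i y *\<^sub>R s i y))
      = J x ((\<Sum>i\<in>I. v (c i) *\<^sub>R s i x) + (\<Sum>i\<in>I. c i x *\<^sub>R D x v (s i)))"
    by (simp add: connection_linear_combination[OF D W(1,2) sm] sum.distrib)
  also have "\<dots> = J x (\<Sum>i\<in>I. v (c i) *\<^sub>R s i x) + J x (\<Sum>i\<in>I. c i x *\<^sub>R D x v (s i))"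
    using fib W(2) DF
    by (intro End_section_linear(2)[OF J x]) (simp_all add: subspace_sum subspace_scale subspace_fibre)
  also have "\<dots> = (\<Sum>i\<in>I. v (c i) *\<^sub>R J x (s i x)) + (\<Sum>i\<in>I. c i x *\<^sub>R J x (D x v (s i)))"
    using W(2) by (simp add: End_section_sum[OF J x] fib DF)
  finally show ?thesis
    using 1 unfolding cov_End_def by (simp add: sum_subtractf scaleR_diff_right)
qed

end


subsection \<open>Orthonormal frames\<close>

text \<open>The value of \<open>h\<close> on the \<open>i\<close>-th frame vector paired with
  itself. Being its own inverse, it also converts products with frame vectors into
  coefficients.\<close>

definition metric_sign :: "nat \<Rightarrow> nat \<Rightarrow> real" where
  "metric_sign n i = (if i \<le> 2 * n then 1 else -1)"

lemma metric_sign_square [simp]: "metric_sign n i * metric_sign n i = 1"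
  by (simp add: metric_sign_def)

lemma pseudo_orthonormalD:
  "pseudo_orthonormal (4 * n) (2 * n) g b \<Longrightarrow> i \<in> {1..4 * n} \<Longrightarrow> j \<in> {1..4 * n} \<Longrightarrow>
    g (b i) (b j) = (if i = j then metric_sign n i else 0)"
  by (simp add: pseudo_orthonormal_def metric_sign_def)

locale neutral_bundle = smooth_vector_bundle A "4 * n" E
  for A :: "('m::{t2_space,second_countable_topology}, 'b::real_normed_vector) atlas"
    and n :: nat and E :: "('m, 'v::real_vector) vbundle" +
  fixes h :: "'m \<Rightarrow> 'v \<Rightarrow> 'v \<Rightarrow> real"
  assumes metric: "neutral_metric A n E h"
begin

lemma
  assumes "u \<in> fibre E x" "u' \<in> fibre E x" "w \<in> fibre E x"
  shows metric_sym: "h x u w = h x w u"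
    and metric_add_left: "h x (u + u') w = h x u w + h x u' w"
    and metric_scaleR_left: "h x (c *\<^sub>R u) w = c * h x u w"
  using conjunct1[OF metric[unfolded neutral_metric_def], THEN spec[of _ x], THEN bspec[OF _ assms(1)],
      THEN bspec[OF _ assms(2)], THEN bspec[OF _ assms(3)]] by simp_all

lemma metric_smooth:
  assumes "open W" "smooth_section A (4 * n) E W s" "smooth_section A (4 * n) E W t"
  shows "smooth_fun A W (\<lambda>x. h x (s x) (t x))"
  using conjunct2[OF conjunct2[OF conjunct2[OF metric[unfolded neutral_metric_def]]],
      THEN spec[of _ W], THEN spec[of _ s], THEN spec[of _ t]] assms by simp

lemma metric_sum_left:
  assumes "\<And>i. i \<in> I \<Longrightarrow> u i \<in> fibre E x" "w \<in> fibre E x"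
  shows "h x (\<Sum>i\<in>I. a i *\<^sub>R u i) w = (\<Sum>i\<in>I. a i * h x (u i) w)"
proof -
  have zero: "h x 0 w = 0"
    using metric_scaleR_left[of 0 x 0 w 0] subspace_0[OF subspace_fibre[of x]] assms(2) by simp
  show ?thesis using assms(1)
  proof (induction I rule: infinite_finite_induct)
    case (insert i I)
    then have "(\<Sum>i\<in>I. a i *\<^sub>R u i) \<in> fibre E x" "u i \<in> fibre E x" "a i *\<^sub>R u i \<in> fibre E x"
      by (auto intro!: subspace_sum subspace_scale subspace_fibre)
    with insert assms(2) show ?case
      by (simp add: metric_add_left metric_scaleR_left[of _ _ w])
  qed (simp_all add: zero)
qed

lemma pseudo_orthonormal_coefficient:
  assumes "pseudo_orthonormal (4 * n) (2 * n) (h x) b" "\<And>i. i \<in> {1..4 * n} \<Longrightarrow> b i \<in> fibre E x"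
    and "j \<in> {1..4 * n}"
  shows "h x (\<Sum>i\<in>{1..4 * n}. a i *\<^sub>R b i) (b j) = metric_sign n j * a j"
proof -
  have "h x (\<Sum>i\<in>{1..4 * n}. a i *\<^sub>R b i) (b j) = (\<Sum>i\<in>{1..4 * n}. a i * h x (b i) (b j))"
    using assms(2,3) by (intro metric_sum_left)
  also have "\<dots> = (\<Sum>i\<in>{1..4 * n}. if i = j then metric_sign n j * a j else 0)"
    using pseudo_orthonormalD[OF assms(1) _ assms(3)] by (intro sum.cong) auto
  also have "\<dots> = metric_sign n j * a j"
    using assms(3) by (simp only: sum.delta finite_atLeastAtMost if_True)
  finally show ?thesis .
qed

text \<open>Pairing a vanishing combination with \<open>b j\<close> isolates its \<open>j\<close>-th
  coefficient up to sign, and equal vectors at distinct indices would have product 0 but nonzero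
  square. So spanning is all that remains to be checked when the signs in a frame are
  changed.\<close>

lemma pseudo_orthonormal_ordered_basis:
  assumes orth: "pseudo_orthonormal (4 * n) (2 * n) (h x) b"
    and fib: "\<And>i. i \<in> {1..4 * n} \<Longrightarrow> b i \<in> fibre E x"
    and span: "fibre E x \<subseteq> span (b ` {1..4 * n})"
  shows "ordered_basis (4 * n) (fibre E x) b"
proof -
  have nz: "metric_sign n i \<noteq> 0" for i by (simp add: metric_sign_def)
  have inj: "inj_on b {1..4 * n}"
  proof (rule inj_onI, rule ccontr)
    fix i j assume ij: "i \<in> {1..4 * n}" "j \<in> {1..4 * n}" "b i = b j" "i \<noteq> j"
    show False
      using pseudo_orthonormalD[OF orth ij(1,2)] pseudo_orthonormalD[OF orth ij(2,2)] ij(3,4) nz by simp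
  qed
  moreover have "independent (b ` {1..4 * n})"
  proof (rule independent_if_scalars_zero)
    fix c w assume c: "(\<Sum>w\<in>b ` {1..4 * n}. c w *\<^sub>R w) = 0" and "w \<in> b ` {1..4 * n}"
    then obtain j where j: "j \<in> {1..4 * n}" "w = b j" by blast
    \<comment> \<open>Zero is written as a combination with zero coefficients, so that the
      coefficient formula applies to both sides.\<close>
    from c have "(\<Sum>i\<in>{1..4 * n}. c (b i) *\<^sub>R b i) = (\<Sum>i\<in>{1..4 * n}. 0 *\<^sub>R b i)"
      by (simp only: sum.reindex[OF inj] comp_def scaleR_zero_left sum.neutral_const)
    then have "metric_sign n j * c (b j) = metric_sign n j * 0"
      using pseudo_orthonormal_coefficient[OF orth fib j(1), of "\<lambda>i. c (b i)"]
        pseudo_orthonormal_coefficient[OF orth fib j(1), of "\<lambda>i. 0"] by metis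
    then show "c w = 0" using j nz by simp
  qed simp
  moreover have "span (b ` {1..4 * n}) = fibre E x"
    using span span_minimal[OF _ subspace_fibre[of x], of "b ` {1..4 * n}"] fib by blast
  ultimately show ?thesis by (simp add: ordered_basis_def)
qed

end

text \<open>The frame is kept abstract because the results are needed for \<open>e\<close>, for eI'
  and for e(\<mu>). Orientation is treated separately, in
  \<open>sign_change_orientation\<close>.\<close>

locale orthonormal_frame = neutral_bundle A n E h
  for A :: "('m::{t2_space,second_countable_topology}, 'b::real_normed_vector) atlas"
    and n :: nat and E :: "('m, 'v::real_vector) vbundle" and h :: "'m \<Rightarrow> 'v \<Rightarrow> 'v \<Rightarrow> real" +
  fixes U :: "'m set" and f :: "nat \<Rightarrow> 'm \<Rightarrow> 'v"
  assumes frame: "local_frame A (4 * n) E U f"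
    and orthonormal: "x \<in> U \<Longrightarrow> pseudo_orthonormal (4 * n) (2 * n) (h x) (\<lambda>i. f i x)"
begin

lemma open_domain: "open U"
  using frame by (simp add: local_frame_def)

lemma frame_smooth: "i \<in> {1..4 * n} \<Longrightarrow> smooth_section A (4 * n) E U (f i)"
  using frame by (simp add: local_frame_def)

lemma frame_fibre: "x \<in> U \<Longrightarrow> i \<in> {1..4 * n} \<Longrightarrow> f i x \<in> fibre E x"
  using frame_smooth by (blast intro: smooth_section_fibre)

lemma frame_basis: "x \<in> U \<Longrightarrow> ordered_basis (4 * n) (fibre E x) (\<lambda>i. f i x)"
  using frame by (simp add: local_frame_def)

lemmas metric_frame = pseudo_orthonormalD[OF orthonormal]

lemma combination_fibre: "x \<in> U \<Longrightarrow> (\<Sum>i\<in>{1..4 * n}. a i *\<^sub>R f i x) \<in> fibre E x"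
  by (intro subspace_sum subspace_scale subspace_fibre frame_fibre)

lemma frame_coefficient:
  assumes "x \<in> U" "j \<in> {1..4 * n}"
  shows "h x (\<Sum>i\<in>{1..4 * n}. a i *\<^sub>R f i x) (f j x) = metric_sign n j * a j"
  using pseudo_orthonormal_coefficient[OF orthonormal[OF assms(1)] frame_fibre[OF assms(1)] assms(2)] .

text \<open>The basis property provides some coefficients; pairing with the frame identifies them
  with an explicit expression in \<open>h\<close>.\<close>

lemma frame_expansion:
  assumes "x \<in> U" "u \<in> fibre E x"
  shows "(\<Sum>i\<in>{1..4 * n}. (metric_sign n i * h x u (f i x)) *\<^sub>R f i x) = u"
proof -
  have b: "inj_on (\<lambda>i. f i x) {1..4 * n}" "u \<in> span ((\<lambda>i. f i x) ` {1..4 * n})"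
    using frame_basis[OF assms(1)] assms(2) by (auto simp: ordered_basis_def)
  from b(2) obtain c where "u = (\<Sum>w\<in>(\<lambda>i. f i x) ` {1..4 * n}. c w *\<^sub>R w)"
    by (auto simp: span_finite)
  then have u: "u = (\<Sum>i\<in>{1..4 * n}. c (f i x) *\<^sub>R f i x)"
    by (simp only: sum.reindex[OF b(1)] comp_def)
  have "metric_sign n i * h x u (f i x) = c (f i x)" if "i \<in> {1..4 * n}" for i
    unfolding u using frame_coefficient[OF assms(1) that] by (simp flip: mult.assoc)
  then have "(\<Sum>i\<in>{1..4 * n}. (metric_sign n i * h x u (f i x)) *\<^sub>R f i x)
      = (\<Sum>i\<in>{1..4 * n}. c (f i x) *\<^sub>R f i x)"
    by (intro sum.cong) simp_all
  with u show ?thesis by simp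
qed

lemma frame_combination_eq_iff:
  assumes "x \<in> U"
  shows "(\<Sum>i\<in>{1..4 * n}. a i *\<^sub>R f i x) = (\<Sum>i\<in>{1..4 * n}. b i *\<^sub>R f i x)
    \<longleftrightarrow> (\<forall>i\<in>{1..4 * n}. a i = b i)" (is "?l = ?r \<longleftrightarrow> _")
proof
  assume eq: "?l = ?r"
  show "\<forall>i\<in>{1..4 * n}. a i = b i"
  proof
    fix i assume i: "i \<in> {1..4 * n}"
    have "metric_sign n i * a i = metric_sign n i * b i"
      using frame_coefficient[OF assms i, of a] frame_coefficient[OF assms i, of b] eq by metis
    then show "a i = b i" by (simp add: metric_sign_def split: if_splits)
  qed
qed (intro sum.cong refl, simp)

text \<open>Because the coordinates are expressed through \<open>h\<close>, their smoothness comes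
  from that of the metric, with no inversion of a matrix of functions.\<close>

lemma frame_coefficient_smooth:
  assumes "open W" "W \<subseteq> U" "smooth_section A (4 * n) E W s" "i \<in> {1..4 * n}"
  shows "smooth_fun A W (\<lambda>x. metric_sign n i * h x (s x) (f i x))"
  using assms smooth_section_subset[OF frame_smooth[OF assms(4)] assms(2)]
  by (intro smooth_fun_mult[OF manifold] smooth_fun_const metric_smooth)

text \<open>The endomorphism with constant matrix \<open>Q\<close> in the frame \<open>f\<close>.
  Reading the coordinates of \<open>u\<close> off the metric avoids any choice and makes smoothness
  immediate.\<close>

definition frame_End :: "(nat \<Rightarrow> nat \<Rightarrow> real) \<Rightarrow> 'm \<Rightarrow> 'v \<Rightarrow> 'v" where
  "frame_End Q x u = (\<Sum>j\<in>{1..4 * n}. (metric_sign n j * h x u (f j x)) *\<^sub>R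
     (\<Sum>i\<in>{1..4 * n}. Q i j *\<^sub>R f i x))"

lemma frame_End_frame:
  assumes "x \<in> U" "j \<in> {1..4 * n}"
  shows "frame_End Q x (f j x) = (\<Sum>i\<in>{1..4 * n}. Q i j *\<^sub>R f i x)"
proof -
  have "frame_End Q x (f j x)
      = (\<Sum>k\<in>{1..4 * n}. if k = j then \<Sum>i\<in>{1..4 * n}. Q i j *\<^sub>R f i x else 0)"
    unfolding frame_End_def using metric_frame[OF assms(1,2)] by (intro sum.cong) auto
  then show ?thesis using assms(2) by (simp only: sum.delta finite_atLeastAtMost if_True)
qed

lemma frame_End_section: "End_section A (4 * n) E U (frame_End Q)"
  unfolding End_section_def
proof (intro conjI ballI allI impI)
  fix x u w c assume x: "x \<in> U" and u: "u \<in> fibre E x" "w \<in> fibre E x"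
  show "frame_End Q x u \<in> fibre E x"
    unfolding frame_End_def using x by (intro subspace_sum subspace_scale subspace_fibre frame_fibre)
  show "frame_End Q x (u + w) = frame_End Q x u + frame_End Q x w"
    unfolding frame_End_def sum.distrib[symmetric]
  proof (rule sum.cong)
    fix j assume "j \<in> {1..4 * n}"
    from metric_add_left[OF u frame_fibre[OF x this]]
    show "(metric_sign n j * h x (u + w) (f j x)) *\<^sub>R (\<Sum>i\<in>{1..4 * n}. Q i j *\<^sub>R f i x)
      = (metric_sign n j * h x u (f j x)) *\<^sub>R (\<Sum>i\<in>{1..4 * n}. Q i j *\<^sub>R f i x)
      + (metric_sign n j * h x w (f j x)) *\<^sub>R (\<Sum>i\<in>{1..4 * n}. Q i j *\<^sub>R f i x)"
      by (simp only: distrib_left scaleR_add_left)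
  qed simp
  show "frame_End Q x (c *\<^sub>R u) = c *\<^sub>R frame_End Q x u"
    unfolding frame_End_def scaleR_sum_right[of c]
  proof (rule sum.cong)
    fix j assume "j \<in> {1..4 * n}"
    from metric_scaleR_left[OF u frame_fibre[OF x this]]
    show "(metric_sign n j * h x (c *\<^sub>R u) (f j x)) *\<^sub>R (\<Sum>i\<in>{1..4 * n}. Q i j *\<^sub>R f i x)
      = c *\<^sub>R (metric_sign n j * h x u (f j x)) *\<^sub>R (\<Sum>i\<in>{1..4 * n}. Q i j *\<^sub>R f i x)"
      by (simp only: scaleR_scaleR mult.left_commute)
  qed simp
next
  fix W s assume W: "open W \<and> W \<subseteq> U \<and> smooth_section A (4 * n) E W s"
  have "smooth_section A (4 * n) E W (f i)" if "i \<in> {1..4 * n}" for i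
    using smooth_section_subset[OF frame_smooth[OF that], of W] W by simp
  then show "smooth_section A (4 * n) E W (\<lambda>x. frame_End Q x (s x))"
    unfolding frame_End_def using W
    by (intro smooth_section_linear_combination frame_coefficient_smooth smooth_fun_const) auto
qed

text \<open>As the entries of \<open>P\<close> are constant, tangent vectors annihilate them and
  only the frame vectors are differentiated: D(Jf) contributes \<theta>P and J(Df) contributes
  P\<theta>.\<close>

lemma cov_End_frame:
  assumes D: "connection A (4 * n) E D" "v \<in> tangent_space A x" and x: "x \<in> U"
    and J: "End_section A (4 * n) E U J"
    and Jf: "\<And>y j. y \<in> U \<Longrightarrow> j \<in> {1..4 * n} \<Longrightarrow> J y (f j y) = (\<Sum>i\<in>{1..4 * n}. P i j *\<^sub>R f i y)"
    and Df: "\<And>j. j \<in> {1..4 * n} \<Longrightarrow> D x v (f j) = (\<Sum>i\<in>{1..4 * n}. \<theta> i j *\<^sub>R f i x)"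
    and j: "j \<in> {1..4 * n}"
  shows "cov_End D J x v (f j)
    = (\<Sum>i\<in>{1..4 * n}. (\<Sum>k\<in>{1..4 * n}. \<theta> i k * P k j - P i k * \<theta> k j) *\<^sub>R f i x)"
proof -
  have "D x v (\<lambda>y. J y (f j y)) = D x v (\<lambda>y. \<Sum>k\<in>{1..4 * n}. P k j *\<^sub>R f k y)"
  proof (rule connection_cong[OF D open_domain x])
    show "smooth_section A (4 * n) E U (\<lambda>y. J y (f j y))"
      by (rule End_section_smooth[OF J open_domain order_refl frame_smooth[OF j]])
    show "smooth_section A (4 * n) E U (\<lambda>y. \<Sum>k\<in>{1..4 * n}. P k j *\<^sub>R f k y)"
      using open_domain frame_smooth by (intro smooth_section_linear_combination smooth_fun_const)
  qed (rule Jf[OF _ j])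
  also have "\<dots> = (\<Sum>k\<in>{1..4 * n}. P k j *\<^sub>R D x v (f k))"
    using connection_linear_combination[OF D open_domain x smooth_fun_const frame_smooth,
        of "{1..4 * n}" "\<lambda>k. k" "\<lambda>k. P k j"]
    by (simp add: tangent_const[OF D(2)])
  also have "\<dots> = (\<Sum>k\<in>{1..4 * n}. \<Sum>i\<in>{1..4 * n}. (\<theta> i k * P k j) *\<^sub>R f i x)"
    by (intro sum.cong refl) (simp add: Df scaleR_sum_right mult.commute)
  finally have 1: "D x v (\<lambda>y. J y (f j y)) = \<dots>" .
  have "J x (D x v (f j)) = (\<Sum>k\<in>{1..4 * n}. \<theta> k j *\<^sub>R J x (f k x))"
    unfolding Df[OF j] by (intro End_section_sum[OF J x] frame_fibre x)
  also have "\<dots> = (\<Sum>k\<in>{1..4 * n}. \<Sum>i\<in>{1..4 * n}. (P i k * \<theta> k j) *\<^sub>R f i x)"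
    by (intro sum.cong refl) (simp add: Jf[OF x] scaleR_sum_right mult.commute)
  finally have 2: "J x (D x v (f j)) = \<dots>" .
  have "cov_End D J x v (f j)
    = (\<Sum>k\<in>{1..4 * n}. \<Sum>i\<in>{1..4 * n}. (\<theta> i k * P k j - P i k * \<theta> k j) *\<^sub>R f i x)"
    unfolding cov_End_def 1 2 by (simp only: sum_subtractf scaleR_diff_left)
  also have "\<dots> = (\<Sum>i\<in>{1..4 * n}. \<Sum>k\<in>{1..4 * n}. (\<theta> i k * P k j - P i k * \<theta> k j) *\<^sub>R f i x)"
    by (rule sum.swap)
  finally show ?thesis by (simp only: scaleR_sum_left)
qed

text \<open>Both sides of \<nabla>J = \<alpha> \<otimes> N are tensorial, so it is enough to test
  frame vectors; uniqueness of coordinates then leaves the matrix equation \<theta>P - P\<theta> =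
  \<alpha>Q.\<close>

lemma cov_End_eq_tensor_iff:
  assumes D: "connection A (4 * n) E D"
    and J: "End_section A (4 * n) E U J" and N: "End_section A (4 * n) E U N"
    and Jf: "\<And>y j. y \<in> U \<Longrightarrow> j \<in> {1..4 * n} \<Longrightarrow> J y (f j y) = (\<Sum>i\<in>{1..4 * n}. P i j *\<^sub>R f i y)"
    and Nf: "\<And>y j. y \<in> U \<Longrightarrow> j \<in> {1..4 * n} \<Longrightarrow> N y (f j y) = (\<Sum>i\<in>{1..4 * n}. Q i j *\<^sub>R f i y)"
    and Df: "\<And>x v j. x \<in> U \<Longrightarrow> v \<in> tangent_space A x \<Longrightarrow> j \<in> {1..4 * n} \<Longrightarrow>
      D x v (f j) = (\<Sum>i\<in>{1..4 * n}. \<theta> i j x v *\<^sub>R f i x)"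
  shows "cov_End_eq_tensor A (4 * n) E D U J \<alpha> N \<longleftrightarrow>
    (\<forall>x\<in>U. \<forall>v\<in>tangent_space A x. \<forall>i\<in>{1..4 * n}. \<forall>j\<in>{1..4 * n}.
      (\<Sum>k\<in>{1..4 * n}. \<theta> i k x v * P k j - P i k * \<theta> k j x v) = \<alpha> x v * Q i j)"
proof -
  have swap: "(\<forall>j\<in>S. \<forall>i\<in>S. R i j) \<longleftrightarrow> (\<forall>i\<in>S. \<forall>j\<in>S. R i j)" for S :: "nat set" and R
    by blast
  have frame_iff: "cov_End D J x v (f j) = \<alpha> x v *\<^sub>R N x (f j x) \<longleftrightarrow> (\<forall>i\<in>{1..4 * n}.
      (\<Sum>k\<in>{1..4 * n}. \<theta> i k x v * P k j - P i k * \<theta> k j x v) = \<alpha> x v * Q i j)"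
    if xvj: "x \<in> U" "v \<in> tangent_space A x" "j \<in> {1..4 * n}" for x v j
  proof -
    have c: "cov_End D J x v (f j)
      = (\<Sum>i\<in>{1..4 * n}. (\<Sum>k\<in>{1..4 * n}. \<theta> i k x v * P k j - P i k * \<theta> k j x v) *\<^sub>R f i x)"
      using xvj Jf Df by (intro cov_End_frame[OF D _ _ J]) blast+
    have "\<alpha> x v *\<^sub>R N x (f j x) = (\<Sum>i\<in>{1..4 * n}. (\<alpha> x v * Q i j) *\<^sub>R f i x)"
      unfolding Nf[OF xvj(1,3)] by (simp only: scaleR_sum_right scaleR_scaleR)
    with c frame_combination_eq_iff[OF xvj(1)] show ?thesis by presburger
  qed
  have "cov_End_eq_tensor A (4 * n) E D U J \<alpha> N \<longleftrightarrow>
    (\<forall>x\<in>U. \<forall>v\<in>tangent_space A x. \<forall>j\<in>{1..4 * n}. cov_End D J x v (f j) = \<alpha> x v *\<^sub>R N x (f j x))"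
    (is "_ \<longleftrightarrow> ?frame")
  proof
    assume t: "cov_End_eq_tensor A (4 * n) E D U J \<alpha> N"
    show ?frame
    proof (intro ballI)
      fix x v j assume "x \<in> U" "v \<in> tangent_space A x" "j \<in> {1..4 * n}"
      then show "cov_End D J x v (f j) = \<alpha> x v *\<^sub>R N x (f j x)"
        using t[unfolded cov_End_eq_tensor_def, THEN spec[of _ U], THEN spec[of _ x], THEN spec[of _ "f j"]]
          open_domain frame_smooth[of j] by blast
    qed
  next
    assume fr: ?frame
    show "cov_End_eq_tensor A (4 * n) E D U J \<alpha> N"
      unfolding cov_End_eq_tensor_def
    proof (intro allI impI ballI)
      fix W x s v
      assume asm: "open W \<and> W \<subseteq> U \<and> x \<in> W \<and> smooth_section A (4 * n) E W s"
        and v: "v \<in> tangent_space A x"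
      \<comment> \<open>The coordinates of \<open>s\<close> in the frame, in the form for which
        smoothness is known.\<close>
      define c where "c i y = metric_sign n i * h y (s y) (f i y)" for i y
      have x: "x \<in> U" using asm by blast
      have s: "(\<Sum>i\<in>{1..4 * n}. c i y *\<^sub>R f i y) = s y" if "y \<in> W" for y
        using frame_expansion[of y "s y"] asm that by (auto simp: c_def smooth_section_fibre)
      have sm: "smooth_fun A W (c i)" "smooth_section A (4 * n) E W (f i)" if "i \<in> {1..4 * n}" for i
        using asm that frame_coefficient_smooth[of W s i] smooth_section_subset[OF frame_smooth[OF that]]
        by (auto simp: c_def[abs_def])
      have sm_sum: "smooth_section A (4 * n) E W (\<lambda>y. \<Sum>i\<in>{1..4 * n}. c i y *\<^sub>R f i y)"
        using sm asm by (intro smooth_section_linear_combination) auto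
      have ss: "smooth_section A (4 * n) E W s" and W: "open W" "x \<in> W" "W \<subseteq> U" using asm by auto
      \<comment> \<open>A connection sees only the germ of a section, so \<open>s\<close> may be
        replaced by its expansion over \<open>W\<close>, also after applying
        \<open>J\<close>.\<close>
      have "D x v s = D x v (\<lambda>y. \<Sum>i\<in>{1..4 * n}. c i y *\<^sub>R f i y)"
        using s by (intro connection_cong[OF D v W(1,2) ss sm_sum]) simp
      moreover have "D x v (\<lambda>y. J y (s y)) = D x v (\<lambda>y. J y (\<Sum>i\<in>{1..4 * n}. c i y *\<^sub>R f i y))"
        using s by (intro connection_cong[OF D v W(1,2) End_section_smooth[OF J W(1,3) ss]
              End_section_smooth[OF J W(1,3) sm_sum]]) simp
      ultimately have "cov_End D J x v s = cov_End D J x v (\<lambda>y. \<Sum>i\<in>{1..4 * n}. c i y *\<^sub>R f i y)"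
        by (simp add: cov_End_def)
      also have "\<dots> = (\<Sum>i\<in>{1..4 * n}. c i x *\<^sub>R cov_End D J x v (f i))"
        by (rule cov_End_linear_combination[OF D v W J sm])
      also have "\<dots> = (\<Sum>i\<in>{1..4 * n}. \<alpha> x v *\<^sub>R c i x *\<^sub>R N x (f i x))"
        using fr x v by (intro sum.cong) (simp_all add: mult.commute)
      also have "\<dots> = \<alpha> x v *\<^sub>R N x (\<Sum>i\<in>{1..4 * n}. c i x *\<^sub>R f i x)"
        using frame_fibre[OF x] by (simp only: End_section_sum[OF N x] scaleR_sum_right)
      finally show "cov_End D J x v s = \<alpha> x v *\<^sub>R N x (s x)" by (simp only: s[OF W(2)])
    qed
  qed
  also have "?frame \<longleftrightarrow> (\<forall>x\<in>U. \<forall>v\<in>tangent_space A x. \<forall>j\<in>{1..4 * n}. \<forall>i\<in>{1..4 * n}.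
      (\<Sum>k\<in>{1..4 * n}. \<theta> i k x v * P k j - P i k * \<theta> k j x v) = \<alpha> x v * Q i j)"
    by (intro ball_cong refl frame_iff)
  also have "\<dots> \<longleftrightarrow> (\<forall>x\<in>U. \<forall>v\<in>tangent_space A x. \<forall>i\<in>{1..4 * n}. \<forall>j\<in>{1..4 * n}.
      (\<Sum>k\<in>{1..4 * n}. \<theta> i k x v * P k j - P i k * \<theta> k j x v) = \<alpha> x v * Q i j)"
    by (rule ball_cong[OF refl], rule ball_cong[OF refl], rule swap)
  finally show ?thesis .
qed

text \<open>Obtained by differentiating the constant functions h(f\<j>, f\<i>) of the frame with
  \<nabla>h = 0.\<close>

lemma connection_form_skew:
  assumes D: "metric_connection A (4 * n) E h D" and x: "x \<in> U" "v \<in> tangent_space A x"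
    and Df: "\<And>j. j \<in> {1..4 * n} \<Longrightarrow> D x v (f j) = (\<Sum>i\<in>{1..4 * n}. \<theta> i j *\<^sub>R f i x)"
    and ij: "i \<in> {1..4 * n}" "j \<in> {1..4 * n}"
  shows "metric_sign n i * \<theta> i j + metric_sign n j * \<theta> j i = 0"
proof -
  have "v (\<lambda>y. h y (f j y) (f i y)) = v (\<lambda>y. if j = i then metric_sign n j else 0)"
    using metric_frame[OF _ ij(2,1)] by (intro tangent_cong[OF x(2) open_domain x(1)])
  also have "\<dots> = 0" by (rule tangent_const[OF x(2)])
  also have "v (\<lambda>y. h y (f j y) (f i y)) = h x (D x v (f j)) (f i x) + h x (f j x) (D x v (f i))"
    using conjunct2[OF D[unfolded metric_connection_def], THEN spec[of _ U], THEN spec[of _ x],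
        THEN spec[of _ "f j"], THEN spec[of _ "f i"]] open_domain x frame_smooth ij by simp
  also have "h x (f j x) (D x v (f i)) = h x (D x v (f i)) (f j x)"
    unfolding Df[OF ij(1)] using frame_fibre[OF x(1) ij(2)] combination_fibre[OF x(1)]
    by (intro metric_sym)
  finally show ?thesis
    by (simp only: Df ij frame_coefficient[OF x(1)])
qed

text \<open>Signs square to 1, so all products of frame vectors with themselves are kept and the
  others stay 0; the basis property then follows from orthonormality and spanning.\<close>

lemma sign_change:
  assumes s: "\<And>i. s i = 1 \<or> s i = (-1::real)"
  shows "orthonormal_frame A n E h U (\<lambda>i x. s i *\<^sub>R f i x)"
proof
  have sq: "s i * s i = 1" for i using s[of i] by auto
  have fib: "s i *\<^sub>R f i x \<in> fibre E x" if "x \<in> U" "i \<in> {1..4 * n}" for x i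
    using frame_fibre[OF that] by (simp add: subspace_scale subspace_fibre)
  show orth: "pseudo_orthonormal (4 * n) (2 * n) (h x) (\<lambda>i. s i *\<^sub>R f i x)" if x: "x \<in> U" for x
    unfolding pseudo_orthonormal_def
  proof (intro ballI)
    fix i j assume ij: "i \<in> {1..4 * n}" "j \<in> {1..4 * n}"
    have "h x (s i *\<^sub>R f i x) (s j *\<^sub>R f j x) = s i * h x (s j *\<^sub>R f j x) (f i x)"
      using metric_scaleR_left[of "f i x" x "f i x" "s j *\<^sub>R f j x"]
        metric_sym[of "f i x" x "f i x" "s j *\<^sub>R f j x"] frame_fibre[OF x ij(1)] fib[OF x ij(2)] by simp
    also have "\<dots> = s i * s j * h x (f j x) (f i x)"
      using metric_scaleR_left[of "f j x" x "f j x" "f i x"] frame_fibre[OF x ij(1)] frame_fibre[OF x ij(2)]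
      by simp
    finally show "h x (s i *\<^sub>R f i x) (s j *\<^sub>R f j x)
        = (if i \<noteq> j then 0 else if i \<le> 2 * n then 1 else - 1)"
      using metric_frame[OF x ij(2,1)] sq[of i] by (auto simp: metric_sign_def)
  qed
  show "local_frame A (4 * n) E U (\<lambda>i x. s i *\<^sub>R f i x)"
    unfolding local_frame_def
  proof (intro conjI ballI)
    show "open U" by (rule open_domain)
    show "smooth_section A (4 * n) E U (\<lambda>x. s i *\<^sub>R f i x)" if "i \<in> {1..4 * n}" for i
      using frame_smooth[OF that] by (intro smooth_section_scaleR open_domain smooth_fun_const)
    fix x assume x: "x \<in> U"
    show "ordered_basis (4 * n) (fibre E x) (\<lambda>i. s i *\<^sub>R f i x)"
    proof (rule pseudo_orthonormal_ordered_basis[OF orth[OF x] fib[OF x]])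
      have "f i x \<in> span ((\<lambda>i. s i *\<^sub>R f i x) ` {1..4 * n})" if i: "i \<in> {1..4 * n}" for i
        \<comment> \<open>Multiplying by \<open>s i\<close> a second time recovers
          \<open>f i x\<close>.\<close>
        using span_scale[OF span_base[OF imageI[OF i]], of "s i" "\<lambda>i. s i *\<^sub>R f i x"] by (simp add: sq)
      then have "span ((\<lambda>i. f i x) ` {1..4 * n}) \<subseteq> span ((\<lambda>i. s i *\<^sub>R f i x) ` {1..4 * n})"
        by (intro span_minimal) (auto intro: subspace_span)
      then show "fibre E x \<subseteq> span ((\<lambda>i. s i *\<^sub>R f i x) ` {1..4 * n})"
        using frame_basis[OF x] by (simp add: ordered_basis_def)
    qed
  qed
qed

text \<open>The change of basis is the diagonal matrix of the signs, whose determinant is their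
  product.\<close>

lemma sign_change_orientation:
  assumes s: "\<And>i. s i = 1 \<or> s i = (-1::real)" and prod: "(\<Prod>i\<in>{1..4 * n}. s i) > 0"
    and ori: "bundle_orientation A (4 * n) E ori" "(\<lambda>i. f i x) \<in> ori x" and x: "x \<in> U"
  shows "(\<lambda>i. s i *\<^sub>R f i x) \<in> ori x"
proof -
  interpret s: orthonormal_frame A n E h U "\<lambda>i x. s i *\<^sub>R f i x"
    by (rule sign_change[OF s])
  define g where "g i j = (if i = j then s i else 0)" for i j :: nat
  let ?g = "Matrix.mat (4 * n) (4 * n) (\<lambda>(i, j). g (Suc i) (Suc j))"
  have "Determinant.det ?g = prod_list (diag_mat ?g)"
    by (rule det_upper_triangular[of _ "4 * n"]) (auto simp: g_def upper_triangular_def)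
  also have "\<dots> = (\<Prod>i\<in>{0..<4 * n}. s (Suc i))"
    by (simp add: diag_mat_def g_def prod.list_conv_set_nth)
  \<comment> \<open>Matrix indices start at 0 and frame indices at 1, hence the shift.\<close>
  also have "\<dots> = (\<Prod>i\<in>{1..4 * n}. s i)"
    by (simp only: prod.shift_bounds_Suc_ivl[symmetric] atLeastLessThanSuc_atLeastAtMost One_nat_def)
  finally have det: "Determinant.det ?g > 0" using prod by simp
  have "s j *\<^sub>R f j x = (\<Sum>i\<in>{1..4 * n}. g i j *\<^sub>R f i x)" if "j \<in> {1..4 * n}" for j
  proof -
    have "(\<Sum>i\<in>{1..4 * n}. g i j *\<^sub>R f i x) = (\<Sum>i\<in>{1..4 * n}. if i = j then s j *\<^sub>R f j x else 0)"
      by (intro sum.cong) (auto simp: g_def)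
    then show ?thesis using that by (simp only: sum.delta finite_atLeastAtMost if_True)
  qed
  with det have "same_orientation (4 * n) (\<lambda>i. f i x) (\<lambda>i. s i *\<^sub>R f i x)"
    unfolding same_orientation_def by (intro exI[of _ g]) blast
  moreover note conjunct2[OF conjunct1[OF ori(1)[unfolded bundle_orientation_def],
        THEN spec[of _ x], THEN bspec[OF _ ori(2)]], THEN spec, THEN mp, OF s.frame_basis[OF x]]
  ultimately show ?thesis by simp
qed

end


subsection \<open>Block matrices\<close>

lemma sum_four_blocks:
  fixes F :: "nat \<Rightarrow> 'c::comm_monoid_add"
  shows "(\<Sum>k\<in>{1..4 * n}. F k)
    = (\<Sum>k\<in>{1..n}. F k) + (\<Sum>k\<in>{1..n}. F (n + k)) + (\<Sum>k\<in>{1..n}. F (2 * n + k)) + (\<Sum>k\<in>{1..n}. F (3 * n + k))"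
proof -
  have "sum F {1..p + n} = sum F {1..p} + (\<Sum>k\<in>{1..n}. F (p + k))" for p
  proof -
    have "sum F {1..p + n} = sum F {1..p} + sum F {p + 1..p + n}"
      by (rule sum.ub_add_nat) simp
    also have "sum F {p + 1..p + n} = (\<Sum>k\<in>{1..n}. F (p + k))"
      using sum.shift_bounds_cl_nat_ivl[of F 1 p n] by (simp only: add.commute[of _ p])
    finally show ?thesis .
  qed
  from this[of n] this[of "2 * n"] this[of "3 * n"]
  have "sum F {1..n + n} = sum F {1..n} + (\<Sum>k\<in>{1..n}. F (n + k))"
    "sum F {1..2 * n + n} = sum F {1..2 * n} + (\<Sum>k\<in>{1..n}. F (2 * n + k))"
    "sum F {1..3 * n + n} = sum F {1..3 * n} + (\<Sum>k\<in>{1..n}. F (3 * n + k))" .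
  moreover have "n + n = 2 * n" "2 * n + n = 3 * n" "3 * n + n = 4 * n" by simp_all
  ultimately show ?thesis by (simp only:)
qed

lemma all_less_four: "(\<forall>p<4::nat. R p) \<longleftrightarrow> R 0 \<and> R 1 \<and> R 2 \<and> R 3"
  by (auto simp: numeral_eq_Suc less_Suc_eq)

text \<open>Indices start at 1, so block \<open>p\<close> consists of \<open>p * n + 1\<close> up to
  \<open>p * n + n\<close>. This splits an equation of matrices into sixteen block
  equations.\<close>

lemma ball_four_blocks:
  fixes n :: nat
  shows "(\<forall>i\<in>{1..4 * n}. R i) \<longleftrightarrow> (\<forall>i\<in>{1..n}. \<forall>p<4. R (p * n + i))"
proof
  assume "\<forall>i\<in>{1..n}. \<forall>p<4. R (p * n + i)"
  then have R: "R j" "R (n + j)" "R (2 * n + j)" "R (3 * n + j)" if "j \<in> {1..n}" for j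
    using that by (simp_all add: all_less_four)
  show "\<forall>i\<in>{1..4 * n}. R i"
  proof
    fix i assume "i \<in> {1..4 * n}"
    then consider "i \<le> n" | "n < i" "i \<le> 2 * n" | "2 * n < i" "i \<le> 3 * n" | "3 * n < i" "i \<le> 4 * n"
      by fastforce
    then show "R i"
    proof cases
      case 1
      then show ?thesis using R(1)[of i] \<open>i \<in> {1..4 * n}\<close> by simp
    next
      case 2
      then have "i - n \<in> {1..n}" by auto
      from R(2)[OF this] show ?thesis using 2 by simp
    next
      case 3
      then have "i - 2 * n \<in> {1..n}" by auto
      from R(3)[OF this] show ?thesis using 3 by simp
    next
      case 4
      then have "i - 3 * n \<in> {1..n}" by auto
      from R(4)[OF this] show ?thesis using 4 by simp
    qed
  qed
qed (auto simp: all_less_four)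

lemma ball_ball_four_blocks:
  fixes n :: nat
  shows "(\<forall>i\<in>{1..4 * n}. \<forall>j\<in>{1..4 * n}. R i j)
    \<longleftrightarrow> (\<forall>i\<in>{1..n}. \<forall>j\<in>{1..n}. \<forall>p<4. \<forall>q<4. R (p * n + i) (q * n + j))"
  unfolding ball_four_blocks by blast

lemma block_matrix_entry:
  assumes "i \<in> {1..n}" "j \<in> {1..n}"
  shows "block_matrix n C (p * n + i) (q * n + j) = (if i = j then C ! p ! q else 0)"
proof -
  have "(p * n + i - 1) mod n = i - 1 \<and> (p * n + i - 1) div n = p" if "i \<in> {1..n}" for p i
  proof -
    \<comment> \<open>Since \<open>i \<ge> 1\<close> the subtraction is exact, and
      \<open>i - 1 < n\<close> is the remainder.\<close>
    have "p * n + i - 1 = (i - 1) + p * n" using that by simp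
    moreover have "i - 1 < n" using that by auto
    ultimately show ?thesis by simp
  qed
  with assms show ?thesis by (auto simp: block_matrix_def)
qed

text \<open>Every block is a multiple of the unit matrix, so each of the four contributes only its
  term with \<open>k = j\<close>.\<close>

lemma sum_block_matrix_right:
  fixes W :: "nat \<Rightarrow> real"
  assumes "j \<in> {1..n}"
  shows "(\<Sum>k\<in>{1..4 * n}. W k * block_matrix n C k (q * n + j))
    = W j * C ! 0 ! q + W (n + j) * C ! 1 ! q + W (2 * n + j) * C ! 2 ! q + W (3 * n + j) * C ! 3 ! q"
proof -
  have "(\<Sum>k\<in>{1..n}. W (p * n + k) * block_matrix n C (p * n + k) (q * n + j)) = W (p * n + j) * C ! p ! q" for p
  proof -
    have "(\<Sum>k\<in>{1..n}. W (p * n + k) * block_matrix n C (p * n + k) (q * n + j))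
        = (\<Sum>k\<in>{1..n}. if k = j then W (p * n + j) * C ! p ! q else 0)"
      using assms by (intro sum.cong) (auto simp: block_matrix_entry)
    then show ?thesis using assms by (simp only: sum.delta finite_atLeastAtMost if_True)
  qed
  from this[of 0] this[of 1] this[of 2] this[of 3] show ?thesis
    unfolding sum_four_blocks by simp
qed

lemma sum_block_matrix_left:
  fixes W :: "nat \<Rightarrow> real"
  assumes "i \<in> {1..n}"
  shows "(\<Sum>k\<in>{1..4 * n}. block_matrix n C (p * n + i) k * W k)
    = C ! p ! 0 * W i + C ! p ! 1 * W (n + i) + C ! p ! 2 * W (2 * n + i) + C ! p ! 3 * W (3 * n + i)"
proof -
  have "(\<Sum>k\<in>{1..n}. block_matrix n C (p * n + i) (q * n + k) * W (q * n + k)) = C ! p ! q * W (q * n + i)" for q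
  proof -
    have "(\<Sum>k\<in>{1..n}. block_matrix n C (p * n + i) (q * n + k) * W (q * n + k))
        = (\<Sum>k\<in>{1..n}. if k = i then C ! p ! q * W (q * n + i) else 0)"
      using assms by (intro sum.cong) (auto simp: block_matrix_entry)
    then show ?thesis using assms by (simp only: sum.delta finite_atLeastAtMost if_True)
  qed
  from this[of 0] this[of 1] this[of 2] this[of 3] show ?thesis
    unfolding sum_four_blocks by simp
qed

text \<open>The diagonal entries of \<open>S\<close> and of \<open>I'\<close>.\<close>

definition frame_factor :: "nat \<Rightarrow> real \<Rightarrow> nat \<Rightarrow> real" where
  "frame_factor n \<mu> i = (if i \<le> 2 * n then 1 else \<mu>)"

definition I_sign :: "nat \<Rightarrow> real \<Rightarrow> nat \<Rightarrow> real" where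
  "I_sign n \<epsilon> i = (if i = 3 * n + 1 then \<epsilon> else 1)"

text \<open>Since P squares to the identity, WP - PW anticommutes with P, and so does S\<Lambda>S;
  block rows 2 and 3, counted from 0, are therefore determined by rows 0 and 1. The blocks (0,1) and
  (0,3) are obtained from (1,0) and (1,2) by transposition and skewness, and the remaining six are
  the conditions on the right.\<close>

lemma commutator_paracomplex_eq_nilpotent_iff:
  fixes W :: "nat \<Rightarrow> nat \<Rightarrow> real" and a \<mu> :: real
  assumes skew: "\<And>i j. i \<in> {1..4 * n} \<Longrightarrow> j \<in> {1..4 * n} \<Longrightarrow>
      metric_sign n i * W i j + metric_sign n j * W j i = 0"
    and \<mu>: "\<mu> \<in> {1, -1}"
  shows "(\<forall>i\<in>{1..4 * n}. \<forall>j\<in>{1..4 * n}.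
      (\<Sum>k\<in>{1..4 * n}. W i k * paracomplex_matrix n k j - paracomplex_matrix n i k * W k j)
        = a * (frame_factor n \<mu> i * Lambda_matrix n i j * frame_factor n \<mu> j))
    \<longleftrightarrow> (\<forall>i\<in>{1..n}. \<forall>j\<in>{1..n}.
      \<mu> * (W (n + i) j + W (3 * n + i) (2 * n + j)) = W (n + i) (2 * n + j) + W (3 * n + i) j \<and>
      W (n + i) (2 * n + j) + W (3 * n + i) j = a * real (kdelta i j) \<and>
      W i j - W (2 * n + i) (2 * n + j) = 0 \<and>
      W i (2 * n + j) - W (2 * n + i) j = 0 \<and>
      W (n + i) (n + j) - W (3 * n + i) (3 * n + j) = 0 \<and>
      W (n + i) (3 * n + j) - W (3 * n + i) (n + j) = 0)" (is "?l \<longleftrightarrow> (\<forall>i\<in>{1..n}. \<forall>j\<in>{1..n}. ?B i j)")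
proof -
  let ?P = "paracomplex_matrix n" and ?m = "frame_factor n \<mu>"
  let ?e = "\<lambda>i j. (\<Sum>k\<in>{1..4 * n}. W i k * ?P k j - ?P i k * W k j) = a * (?m i * Lambda_matrix n i j * ?m j)"
  define E where "E i j \<longleftrightarrow> (\<forall>p<4. \<forall>q<4. ?e (p * n + i) (q * n + j))" for i j
  have l: "?l \<longleftrightarrow> (\<forall>i\<in>{1..n}. \<forall>j\<in>{1..n}. E i j)"
    unfolding E_def by (rule ball_ball_four_blocks)
  \<comment> \<open>The first bracket is block row 0, the second block row 1; the other two rows
    repeat them.\<close>
  have E: "E i j \<longleftrightarrow>
      (W i (2 * n + j) - W (2 * n + i) j = 0 \<and> W i (3 * n + j) + W (2 * n + i) (n + j) = a * real (kdelta i j) \<and>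
       W i j - W (2 * n + i) (2 * n + j) = 0 \<and>
       W i (n + j) + W (2 * n + i) (3 * n + j) = - (\<mu> * (a * real (kdelta i j)))) \<and>
      (W (n + i) (2 * n + j) + W (3 * n + i) j = a * real (kdelta i j) \<and>
       W (n + i) (3 * n + j) - W (3 * n + i) (n + j) = 0 \<and>
       W (n + i) j + W (3 * n + i) (2 * n + j) = \<mu> * (a * real (kdelta i j)) \<and>
       W (n + i) (n + j) - W (3 * n + i) (3 * n + j) = 0)"
    if ij: "i \<in> {1..n}" "j \<in> {1..n}" for i j
  proof -
    have m: "frame_factor n c k = 1" "frame_factor n c (n + k) = 1"
      "frame_factor n c (2 * n + k) = c" "frame_factor n c (3 * n + k) = c" if "k \<in> {1..n}" for k c
      using that by (auto simp: frame_factor_def)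
    have "E i j \<longleftrightarrow> (\<forall>p<4. \<forall>q<4.
        (\<Sum>k\<in>{1..4 * n}. W (p * n + i) k * ?P k (q * n + j)) - (\<Sum>k\<in>{1..4 * n}. ?P (p * n + i) k * W k (q * n + j))
        = a * (?m (p * n + i) * Lambda_matrix n (p * n + i) (q * n + j) * ?m (q * n + j)))"
      unfolding E_def by (simp only: sum_subtractf)
    note * = this[unfolded paracomplex_matrix_def Lambda_matrix_def sum_block_matrix_right[OF ij(2)] sum_block_matrix_left[OF ij(1)]
        block_matrix_entry[OF ij] all_less_four]
    show ?thesis
      \<comment> \<open>Deciding \<open>i = j\<close> and the sign \<mu> makes all sixteen equations
        linear in \<open>a\<close> and the entries of \<open>W\<close>.\<close>
      using \<mu> unfolding *
      by (cases "i = j"; cases "\<mu> = 1"; simp add: m[OF ij(1)] m[OF ij(2)] kdelta_def; argo)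
  qed
  have \<mu>_cases: "\<mu> = 1 \<or> \<mu> = -1" using \<mu> by simp
  show ?thesis
  proof
    assume ?l
    show "\<forall>i\<in>{1..n}. \<forall>j\<in>{1..n}. ?B i j"
    proof (intro ballI)
      fix i j assume ij: "i \<in> {1..n}" "j \<in> {1..n}"
      from bspec[OF bspec[OF \<open>?l\<close>[unfolded l] ij(1)] ij(2)]
      have "E i j" .
      note e = this[unfolded E[OF ij]]
      from \<mu>_cases show "?B i j"
      proof
        assume "\<mu> = 1"
        with e show "?B i j" unfolding \<open>\<mu> = 1\<close> mult_1 by argo
      next
        assume "\<mu> = -1"
        with e show "?B i j" unfolding \<open>\<mu> = -1\<close> mult_minus1 by argo
      qed
    qed
  next
    assume B: "\<forall>i\<in>{1..n}. \<forall>j\<in>{1..n}. ?B i j"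
    show ?l unfolding l
    proof (intro ballI)
      fix i j assume ij: "i \<in> {1..n}" "j \<in> {1..n}"
      \<comment> \<open>Entries mixing a space-like and a time-like index are symmetric, the others
        antisymmetric.\<close>
      have sk: "W i (3 * n + j) = W (3 * n + j) i" "W (2 * n + i) (n + j) = W (n + j) (2 * n + i)"
        "W i (n + j) = - W (n + j) i" "W (2 * n + i) (3 * n + j) = - W (3 * n + j) (2 * n + i)"
        using skew[of i "3 * n + j"] skew[of "2 * n + i" "n + j"] skew[of i "n + j"]
          skew[of "2 * n + i" "3 * n + j"] ij by (auto simp: metric_sign_def)
      have \<delta>: "kdelta j i = kdelta i j" by (simp add: kdelta_def)
      \<comment> \<open>Transposition exchanges \<open>i\<close> and \<open>j\<close>, so the
        conditions are needed at both pairs.\<close>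
      note b = bspec[OF bspec[OF B ij(1)] ij(2)] bspec[OF bspec[OF B ij(2)] ij(1), unfolded \<delta>]
      from \<mu>_cases show "E i j"
      proof
        assume "\<mu> = 1"
        show "E i j" unfolding E[OF ij] using b sk unfolding \<open>\<mu> = 1\<close> mult_1 by argo
      next
        assume "\<mu> = -1"
        show "E i j" unfolding E[OF ij] using b sk unfolding \<open>\<mu> = -1\<close> mult_minus1 by argo
      qed
    qed
  qed
qed


subsection \<open>Admissible frames\<close>

lemma frame_mult_I_prime:
  assumes "j \<in> {1..4 * n}"
  shows "frame_mult (4 * n) e (I_prime n \<epsilon>) j x = I_sign n \<epsilon> j *\<^sub>R e j x"
proof -
  have "frame_mult (4 * n) e (I_prime n \<epsilon>) j x
      = (\<Sum>i\<in>{1..4 * n}. if i = j then I_sign n \<epsilon> j *\<^sub>R e j x else 0)"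
    unfolding frame_mult_def by (intro sum.cong) (auto simp: I_prime_def I_sign_def)
  then show ?thesis using assms by (simp only: sum.delta finite_atLeastAtMost if_True)
qed

lemma acts_by_matrix_iff:
  "acts_by_matrix n \<epsilon> P U e N \<longleftrightarrow> (\<forall>x\<in>U. \<forall>j\<in>{1..4 * n}.
    N x (I_sign n \<epsilon> j *\<^sub>R e j x) = (\<Sum>i\<in>{1..4 * n}. P i j *\<^sub>R I_sign n \<epsilon> i *\<^sub>R e i x))"
proof -
  have "frame_mult (4 * n) (frame_mult (4 * n) e (I_prime n \<epsilon>)) P j x
      = (\<Sum>i\<in>{1..4 * n}. P i j *\<^sub>R I_sign n \<epsilon> i *\<^sub>R e i x)" for j x
    unfolding frame_mult_def[of "4 * n" "frame_mult (4 * n) e (I_prime n \<epsilon>)"]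
    by (intro sum.cong refl) (simp add: frame_mult_I_prime)
  then show ?thesis
    unfolding acts_by_matrix_def Let_def
    by (intro ball_cong refl) (simp only: frame_mult_I_prime)
qed

lemma frame_sign_eq: "frame_sign n e \<mu> = (\<lambda>i x. frame_factor n \<mu> i *\<^sub>R e i x)"
  by (intro ext) (simp add: frame_sign_def frame_factor_def)

text \<open>The sign \<mu> occurs 2n times, an even number; this is why e(\<mu>) has the orientation
  of e.\<close>

lemma prod_frame_factor: "\<mu> \<in> {1, -1} \<Longrightarrow> (\<Prod>i\<in>{1..4 * n}. frame_factor n \<mu> i) = 1"
proof -
  assume \<mu>: "\<mu> \<in> {1, -1}"
  have "(\<Prod>i\<in>{1..2 * n + 2 * n}. frame_factor n \<mu> i)
      = (\<Prod>i\<in>{1..2 * n}. frame_factor n \<mu> i) * (\<Prod>i\<in>{2 * n + 1..2 * n + 2 * n}. frame_factor n \<mu> i)"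
    by (rule prod.ub_add_nat) simp
  also have "(\<Prod>i\<in>{1..2 * n}. frame_factor n \<mu> i) = (\<Prod>i\<in>{1..2 * n}. 1)"
    by (intro prod.cong) (auto simp: frame_factor_def)
  also have "(\<Prod>i\<in>{2 * n + 1..2 * n + 2 * n}. frame_factor n \<mu> i) = (\<Prod>i\<in>{2 * n + 1..2 * n + 2 * n}. \<mu>)"
    by (intro prod.cong) (auto simp: frame_factor_def)
  finally show ?thesis using \<mu> by auto
qed

text \<open>I' and S are diagonal matrices of signs, so they commute and S is its own inverse.
  Passing from e(\<mu>)I' to eI' thus conjugates \<Lambda> by S; here \<open>f\<close> stands for
  e.\<close>

lemma (in orthonormal_frame) acts_by_Lambda_matrix_iff:
  assumes N: "End_section A (4 * n) E U N" and \<mu>: "\<mu> \<in> {1, -1}"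
  shows "acts_by_matrix n \<epsilon> (Lambda_matrix n) U (frame_sign n f \<mu>) N \<longleftrightarrow>
    (\<forall>x\<in>U. \<forall>j\<in>{1..4 * n}. N x (I_sign n \<epsilon> j *\<^sub>R f j x) = (\<Sum>i\<in>{1..4 * n}.
      (frame_factor n \<mu> i * Lambda_matrix n i j * frame_factor n \<mu> j) *\<^sub>R I_sign n \<epsilon> i *\<^sub>R f i x))"
  unfolding acts_by_matrix_iff frame_sign_eq
proof (intro ball_cong refl)
  fix x j assume x: "x \<in> U" and j: "j \<in> {1..4 * n}"
  let ?m = "frame_factor n \<mu>" and ?s = "I_sign n \<epsilon>"
  have m: "?m j * ?m j = 1" using \<mu> by (auto simp: frame_factor_def)
  have "?s j *\<^sub>R f j x \<in> fibre E x"
    by (intro subspace_scale subspace_fibre frame_fibre x j)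
  from End_section_linear(3)[OF N x this this, of "?m j"]
  have l: "N x (?s j *\<^sub>R ?m j *\<^sub>R f j x) = ?m j *\<^sub>R N x (?s j *\<^sub>R f j x)"
    by (simp add: mult.commute)
  have r: "(\<Sum>i\<in>{1..4 * n}. (?m i * Lambda_matrix n i j * ?m j) *\<^sub>R ?s i *\<^sub>R f i x)
      = ?m j *\<^sub>R (\<Sum>i\<in>{1..4 * n}. Lambda_matrix n i j *\<^sub>R ?s i *\<^sub>R ?m i *\<^sub>R f i x)"
    unfolding scaleR_sum_right by (intro sum.cong refl) (simp add: mult.commute mult.left_commute)
  have "?m j *\<^sub>R u = w \<longleftrightarrow> u = ?m j *\<^sub>R w" for u w :: 'v
    using m by (metis scaleR_one scaleR_scaleR)
  then show "N x (?s j *\<^sub>R ?m j *\<^sub>R f j x)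
      = (\<Sum>i\<in>{1..4 * n}. Lambda_matrix n i j *\<^sub>R ?s i *\<^sub>R ?m i *\<^sub>R f i x) \<longleftrightarrow>
    N x (?s j *\<^sub>R f j x) = (\<Sum>i\<in>{1..4 * n}. (?m i * Lambda_matrix n i j * ?m j) *\<^sub>R ?s i *\<^sub>R f i x)"
    unfolding l r .
qed

theorem theorem4p1:
  fixes A :: "('m::{t2_space,second_countable_topology}, 'b::real_normed_vector) atlas"
    and E :: "('m, 'v::real_vector) vbundle"
    and ori :: "'m \<Rightarrow> (nat \<Rightarrow> 'v) set"
    and h :: "'m \<Rightarrow> 'v \<Rightarrow> 'v \<Rightarrow> real"
    and D :: "('m, 'v) conn"
    and J :: "'m \<Rightarrow> 'v \<Rightarrow> 'v"
    and e :: "nat \<Rightarrow> 'm \<Rightarrow> 'v"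
    and \<omega> :: "nat \<Rightarrow> nat \<Rightarrow> 'm \<Rightarrow> 'm tangent \<Rightarrow> real"
    and U :: "'m set"
    and n :: nat
    and \<epsilon> \<mu> :: real
  assumes "n \<ge> 1"
    and "smooth_manifold A"
    and "vector_bundle A (4 * n) E"
    and "bundle_orientation A (4 * n) E ori"
    and "neutral_metric A n E h"
    and "metric_connection A (4 * n) E h D"
    and "\<epsilon> \<in> {1, -1}"
    and "\<mu> \<in> {1, -1}"
    and "paracomplex_structure A n E ori h \<epsilon> J"
    and "paracomplex_admissible A n E ori h \<epsilon> J U e"
    and "connection_form A (4 * n) D U e \<omega>"
  shows "(\<exists>\<alpha> N. one_form A U \<alpha> \<and> nilpotent_structure A n E ori h \<epsilon> U N \<and>
            related_by A n E ori h \<epsilon> N J U e \<mu> \<and>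
            cov_End_eq_tensor A (4 * n) E D U J \<alpha> N)
     \<longleftrightarrow>
         (\<exists>\<alpha>. one_form A U \<alpha> \<and>
            (\<forall>x\<in>U. \<forall>v\<in>tangent_space A x. \<forall>i\<in>{1..n}. \<forall>j\<in>{1..n}.
               \<mu> * (\<omega> (n + i) j x v + \<epsilon> ^ kdelta i 1 * \<omega> (3 * n + i) (2 * n + j) x v)
                 = \<omega> (n + i) (2 * n + j) x v + \<epsilon> ^ kdelta i 1 * \<omega> (3 * n + i) j x v \<and>
               \<omega> (n + i) (2 * n + j) x v + \<epsilon> ^ kdelta i 1 * \<omega> (3 * n + i) j x v
                 = \<alpha> x v * real (kdelta i j) \<and>
               \<omega> i j x v - \<omega> (2 * n + i) (2 * n + j) x v = 0 \<and>
               \<omega> i (2 * n + j) x v - \<omega> (2 * n + i) j x v = 0 \<and>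
               \<omega> (n + i) (n + j) x v
                 - \<epsilon> ^ (kdelta i 1 + kdelta j 1) * \<omega> (3 * n + i) (3 * n + j) x v = 0 \<and>
               \<omega> (n + i) (3 * n + j) x v
                 - \<epsilon> ^ (kdelta i 1 + kdelta j 1) * \<omega> (3 * n + i) (n + j) x v = 0))"
    (is "?a \<longleftrightarrow> (\<exists>\<alpha>. one_form A U \<alpha> \<and> (\<forall>x\<in>U. \<forall>v\<in>tangent_space A x. \<forall>i\<in>{1..n}. \<forall>j\<in>{1..n}. ?b \<alpha> x v i j))")
proof -
  note D = conjunct1[OF assms(6)[unfolded metric_connection_def]]
  have e_frame: "oriented_orthonormal_frame A n E ori h U e"
    and J_acts: "acts_by_matrix n \<epsilon> (paracomplex_matrix n) U e J"
    using assms(10) by (simp_all add: paracomplex_admissible_def)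
  have e_ori: "(\<lambda>i. e i x) \<in> ori x" if "x \<in> U" for x
    using e_frame that by (simp add: oriented_orthonormal_frame_def)
  interpret e: orthonormal_frame A n E h U e
    using assms(2,3,5) e_frame by unfold_locales (simp_all add: oriented_orthonormal_frame_def)
  let ?s = "I_sign n \<epsilon>" and ?m = "frame_factor n \<mu>"
  have s: "?s i = 1 \<or> ?s i = -1" and m: "?m i = 1 \<or> ?m i = -1" for i
    using assms(7,8) by (auto simp: I_sign_def frame_factor_def)
  have ss: "?s i * ?s i = 1" for i using s[of i] by auto
  \<comment> \<open>This is eI', in which \<open>J\<close> has a constant matrix; all computations
    take place in it.\<close>
  interpret f: orthonormal_frame A n E h U "\<lambda>i x. ?s i *\<^sub>R e i x"
    by (rule e.sign_change[OF s])
  interpret g: orthonormal_frame A n E h U "\<lambda>i x. ?m i *\<^sub>R e i x"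
    by (rule e.sign_change[OF m])
  have g_frame: "oriented_orthonormal_frame A n E ori h U (frame_sign n e \<mu>)"
    unfolding oriented_orthonormal_frame_def frame_sign_eq
    using g.frame g.orthonormal
      e.sign_change_orientation[of ?m, OF m _ assms(4) e_ori] prod_frame_factor[OF assms(8), of n]
    by simp
  have "End_section A (4 * n) E UNIV J"
    using assms(9) by (simp add: paracomplex_structure_def)
  then have J: "End_section A (4 * n) E U J" by (simp add: End_section_def)
  let ?P = "paracomplex_matrix n" and ?Q = "\<lambda>i j. ?m i * Lambda_matrix n i j * ?m j"
  \<comment> \<open>The connection form in the frame eI' is I'\<omega>I', because I' is constant and
    its own inverse.\<close>
  let ?W = "\<lambda>i j x v. ?s i * ?s j * \<omega> i j x v"
  have De: "D x v (e j) = (\<Sum>i\<in>{1..4 * n}. \<omega> i j x v *\<^sub>R e i x)"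
    if "x \<in> U" "v \<in> tangent_space A x" "j \<in> {1..4 * n}" for x v j
    using conjunct2[OF assms(11)[unfolded connection_form_def]] that by simp
  have Df: "D x v (\<lambda>y. ?s j *\<^sub>R e j y) = (\<Sum>i\<in>{1..4 * n}. ?W i j x v *\<^sub>R ?s i *\<^sub>R e i x)"
    if xv: "x \<in> U" "v \<in> tangent_space A x" and j: "j \<in> {1..4 * n}" for x v j
  proof -
    have "D x v (\<lambda>y. ?s j *\<^sub>R e j y) = ?s j *\<^sub>R D x v (e j)"
      using e.connection_Leibniz[OF D xv(2) e.open_domain xv(1) e.frame_smooth[OF j] e.frame_smooth[OF j]
          smooth_fun_const[of A U "?s j"]] tangent_const[OF xv(2)] by simp
    also have "\<dots> = (\<Sum>i\<in>{1..4 * n}. (?s j * \<omega> i j x v) *\<^sub>R e i x)"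
      unfolding De[OF xv j] scaleR_sum_right by (simp only: scaleR_scaleR)
    also have "\<dots> = (\<Sum>i\<in>{1..4 * n}. ?W i j x v *\<^sub>R ?s i *\<^sub>R e i x)"
    proof (rule sum.cong[OF refl])
      fix i
      have "?s i * ?s j * \<omega> i j x v * ?s i = (?s i * ?s i) * (?s j * \<omega> i j x v)" by (simp only: mult_ac)
      then show "(?s j * \<omega> i j x v) *\<^sub>R e i x = ?W i j x v *\<^sub>R ?s i *\<^sub>R e i x"
        by (simp only: ss scaleR_scaleR mult_1)
    qed
    finally show ?thesis .
  qed
  have Jf: "J x (?s j *\<^sub>R e j x) = (\<Sum>i\<in>{1..4 * n}. ?P i j *\<^sub>R ?s i *\<^sub>R e i x)"
    if "x \<in> U" "j \<in> {1..4 * n}" for x j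
    using bspec[OF bspec[OF J_acts[unfolded acts_by_matrix_iff] that(1)] that(2)] .
  \<comment> \<open>For fixed \<open>x\<close> and \<open>v\<close> this is a statement about one
    real matrix, skew with respect to \<open>h\<close>.\<close>
  have b: "(\<forall>i\<in>{1..4 * n}. \<forall>j\<in>{1..4 * n}.
      (\<Sum>k\<in>{1..4 * n}. ?W i k x v * ?P k j - ?P i k * ?W k j x v) = \<alpha> x v * ?Q i j)
    \<longleftrightarrow> (\<forall>i\<in>{1..n}. \<forall>j\<in>{1..n}. ?b \<alpha> x v i j)"
    if xv: "x \<in> U" "v \<in> tangent_space A x" for \<alpha> x v
  proof -
    have skew: "metric_sign n i * ?W i j x v + metric_sign n j * ?W j i x v = 0"
      if "i \<in> {1..4 * n}" "j \<in> {1..4 * n}" for i j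
      using f.connection_form_skew[OF assms(6) xv, where \<theta> = "\<lambda>i j. ?W i j x v", OF Df[OF xv] that] .
    note commutator = commutator_paracomplex_eq_nilpotent_iff[of n "\<lambda>i j. ?W i j x v" \<mu> "\<alpha> x v", OF skew assms(8)]
    show ?thesis
    proof (rule trans, rule commutator, assumption, assumption, rule ball_cong[OF refl], rule ball_cong[OF refl])
      fix i j assume ij: "i \<in> {1..n}" "j \<in> {1..n}"
      \<comment> \<open>The entry \<epsilon> of I' sits at \<open>3 * n + 1\<close>, the first place
        of the last block; the powers of \<epsilon> in (b) come from here.\<close>
      have sb: "?s k = 1" "?s (n + k) = 1" "?s (2 * n + k) = 1" "?s (3 * n + k) = \<epsilon> ^ kdelta k 1"
        if "k \<in> {1..n}" for k
        using that by (auto simp: I_sign_def kdelta_def)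
      have ee: "\<epsilon> ^ kdelta k 1 = 1 \<or> \<epsilon> ^ kdelta k 1 = -1" for k
        using assms(7) by (auto simp: kdelta_def)
      show "(\<mu> * (?W (n + i) j x v + ?W (3 * n + i) (2 * n + j) x v)
            = ?W (n + i) (2 * n + j) x v + ?W (3 * n + i) j x v \<and>
          ?W (n + i) (2 * n + j) x v + ?W (3 * n + i) j x v = \<alpha> x v * real (kdelta i j) \<and>
          ?W i j x v - ?W (2 * n + i) (2 * n + j) x v = 0 \<and>
          ?W i (2 * n + j) x v - ?W (2 * n + i) j x v = 0 \<and>
          ?W (n + i) (n + j) x v - ?W (3 * n + i) (3 * n + j) x v = 0 \<and>
          ?W (n + i) (3 * n + j) x v - ?W (3 * n + i) (n + j) x v = 0) \<longleftrightarrow> ?b \<alpha> x v i j"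
        \<comment> \<open>Five conjuncts then agree as they stand; the last equation of (b) is that
          for \<open>?W\<close> multiplied by the sign
          \<open>\<epsilon> ^ kdelta j 1\<close>.\<close>
        unfolding sb[OF ij(1)] sb[OF ij(2)] power_add mult_1 mult_1_right
        using ee[of i] ee[of j]
        by (elim disjE) (simp_all only: mult_1 mult_1_right mult_minus1 mult_minus1_right minus_minus, argo+)
    qed
  qed
  \<comment> \<open>The right side does not mention \<open>N\<close>, so this serves both directions
    with the same \<alpha>.\<close>
  have tensor: "cov_End_eq_tensor A (4 * n) E D U J \<alpha> N
    \<longleftrightarrow> (\<forall>x\<in>U. \<forall>v\<in>tangent_space A x. \<forall>i\<in>{1..n}. \<forall>j\<in>{1..n}. ?b \<alpha> x v i j)"
    if N: "End_section A (4 * n) E U N"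
      "acts_by_matrix n \<epsilon> (Lambda_matrix n) U (frame_sign n e \<mu>) N" for \<alpha> N
  proof -
    have Nf: "N x (?s j *\<^sub>R e j x) = (\<Sum>i\<in>{1..4 * n}. ?Q i j *\<^sub>R ?s i *\<^sub>R e i x)"
      if "x \<in> U" "j \<in> {1..4 * n}" for x j
      using bspec[OF bspec[OF N(2)[unfolded e.acts_by_Lambda_matrix_iff[OF N(1) assms(8)]] that(1)] that(2)] .
    have "cov_End_eq_tensor A (4 * n) E D U J \<alpha> N \<longleftrightarrow> (\<forall>x\<in>U. \<forall>v\<in>tangent_space A x.
      \<forall>i\<in>{1..4 * n}. \<forall>j\<in>{1..4 * n}.
      (\<Sum>k\<in>{1..4 * n}. ?W i k x v * ?P k j - ?P i k * ?W k j x v) = \<alpha> x v * ?Q i j)"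
      using f.cov_End_eq_tensor_iff[OF D J N(1), where P = ?P and Q = ?Q and \<theta> = ?W and \<alpha> = \<alpha>,
          OF Jf Nf Df] .
    also have "\<dots> \<longleftrightarrow> (\<forall>x\<in>U. \<forall>v\<in>tangent_space A x. \<forall>i\<in>{1..n}. \<forall>j\<in>{1..n}. ?b \<alpha> x v i j)"
      by (rule ball_cong[OF refl], rule ball_cong[OF refl], rule b)
    finally show ?thesis .
  qed
  show ?thesis
  proof
    assume ?a
    then obtain \<alpha> N where \<alpha>: "one_form A U \<alpha>" and N: "nilpotent_structure A n E ori h \<epsilon> U N"
      "related_by A n E ori h \<epsilon> N J U e \<mu>" and t: "cov_End_eq_tensor A (4 * n) E D U J \<alpha> N"
      by (elim exE conjE)
    have "End_section A (4 * n) E U N"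
      using N(1) by (simp add: nilpotent_structure_def)
    moreover have "acts_by_matrix n \<epsilon> (Lambda_matrix n) U (frame_sign n e \<mu>) N"
      using N(2) by (simp add: related_by_def nilpotent_admissible_def)
    ultimately show "\<exists>\<alpha>. one_form A U \<alpha> \<and>
        (\<forall>x\<in>U. \<forall>v\<in>tangent_space A x. \<forall>i\<in>{1..n}. \<forall>j\<in>{1..n}. ?b \<alpha> x v i j)"
      using tensor[THEN iffD1, OF _ _ t] by (intro exI[of _ \<alpha>] conjI \<alpha>)
  next
    assume "\<exists>\<alpha>. one_form A U \<alpha> \<and>
        (\<forall>x\<in>U. \<forall>v\<in>tangent_space A x. \<forall>i\<in>{1..n}. \<forall>j\<in>{1..n}. ?b \<alpha> x v i j)"
    then obtain \<alpha> where \<alpha>: "one_form A U \<alpha>"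
      and t: "\<forall>x\<in>U. \<forall>v\<in>tangent_space A x. \<forall>i\<in>{1..n}. \<forall>j\<in>{1..n}. ?b \<alpha> x v i j"
      by (elim exE conjE)
    \<comment> \<open>Admissibility of e(\<mu>) dictates the choice: the endomorphism with matrix
      S\<Lambda>S in the frame eI'.\<close>
    define N where "N = f.frame_End ?Q"
    have N: "End_section A (4 * n) E U N"
      unfolding N_def by (rule f.frame_End_section)
    have N_acts: "acts_by_matrix n \<epsilon> (Lambda_matrix n) U (frame_sign n e \<mu>) N"
      unfolding e.acts_by_Lambda_matrix_iff[OF N assms(8)] unfolding N_def
      by (intro ballI f.frame_End_frame)
    with g_frame have adm: "nilpotent_admissible A n E ori h \<epsilon> N U (frame_sign n e \<mu>)"
      by (simp add: nilpotent_admissible_def)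
    \<comment> \<open>The frame e(\<mu>) is defined on all of \<open>U\<close> and is admissible
      near each of its points.\<close>
    have "nilpotent_structure A n E ori h \<epsilon> U N"
      unfolding nilpotent_structure_def
      by (intro conjI N ballI exI[of _ U] exI[of _ "frame_sign n e \<mu>"] adm order_refl)
    moreover have "related_by A n E ori h \<epsilon> N J U e \<mu>"
      using assms(10) adm by (simp add: related_by_def)
    ultimately show ?a
      using tensor[OF N N_acts, THEN iffD2, OF t] by (intro exI[of _ \<alpha>] exI[of _ N] conjI \<alpha>)
  qed
qed

end
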